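(* Let $X$ be a hereditarily indecomposable continuum. Suppose that $X$ embeds essentially into $\mathbb{S}^1\times I^\infty$. Then $X$ is not continuously homogeneous.
   Context: A continuum is a compact and connected metric space; a map is a continuous function. A continuum $X$ is continuously homogeneous if for any $x,y\in X$ there exists a continuous surjection $f:X\to X$ with $f(x)=y$. A continuum $X$ is indecomposable if, whenever $A,B\subset X$ are subcontinua with $A\cup B=X$, we have $A=X$ or $B=X$; $X$ is hereditarily indecomposable if each subcontinuum of $X$ is indecomposable. $\mathbb{S}^1$ is the unit circle and $I^\infty$ is the Hilbert cube. $X$ embeds essentially into $\mathbb{S}^1\times I^\infty$ if there is a topological embedding $e:X\to\mathbb{S}^1\times I^\infty$ that is essential, i.e. not homotopic to a constant map. *)

theory Defs
  imports "HOL-Analysis.Analysis"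
begin

text \<open>
  Continua are represented as subsets of an arbitrary type of class \<^class>\<open>metric_space\<close>.
  Since \<^const>\<open>connected\<close> admits the empty set, so does this definition; this is harmless
  below because maps out of the empty space are never essential and an empty subcontinuum
  does not affect indecomposability.
\<close>

definition continuum :: "'a::metric_space set \<Rightarrow> bool" where
  "continuum X \<longleftrightarrow> compact X \<and> connected X"

definition indecomposable :: "'a::metric_space set \<Rightarrow> bool" where
  "indecomposable X \<longleftrightarrow>
     (\<forall>A B. A \<subseteq> X \<and> B \<subseteq> X \<and> continuum A \<and> continuum B \<and> A \<union> B = X \<longrightarrow> A = X \<or> B = X)"

definition hereditarily_indecomposable :: "'a::metric_space set \<Rightarrow> bool" where
  "hereditarily_indecomposable X \<longleftrightarrow>
     (\<forall>K. K \<subseteq> X \<and> continuum K \<longrightarrow> indecomposable K)"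

definition continuously_homogeneous :: "'a::metric_space set \<Rightarrow> bool" where
  "continuously_homogeneous X \<longleftrightarrow>
     (\<forall>x\<in>X. \<forall>y\<in>X. \<exists>f. continuous_on X f \<and> f ` X = X \<and> f x = y)"

text \<open>The type \<^typ>\<open>nat \<Rightarrow> real\<close> carries the product topology.\<close>

definition hilbert_cube :: "(nat \<Rightarrow> real) set" where
  "hilbert_cube = (\<Pi> n\<in>UNIV. {0..1})"

definition essential_map ::
    "'a::topological_space set \<Rightarrow> 'b::topological_space set \<Rightarrow> ('a \<Rightarrow> 'b) \<Rightarrow> bool" where
  "essential_map X Y f \<longleftrightarrow>
     continuous_on X f \<and> f ` X \<subseteq> Y \<and>
     \<not> (\<exists>c\<in>Y. homotopic_with_canon (\<lambda>_. True) X Y f (\<lambda>_. c))"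

definition embeds_essentially ::
    "'a::topological_space set \<Rightarrow> 'b::topological_space set \<Rightarrow> bool" where
  "embeds_essentially X Y \<longleftrightarrow>
     (\<exists>e. embedding_map (top_of_set X) (top_of_set Y) e \<and> essential_map X Y e)"

end

theory Submission imports Defs begin

text \<open>
  An essential map \<open>f : X \<rightarrow> S\<^sup>1\<close> pulls the covering \<open>\<real> \<rightarrow> S\<^sup>1\<close> back to a covering of \<open>X\<close>.
  Hereditary indecomposability passes to the compact subcontinua of this covering space: any two
  that meet are nested. So the heights of the continua through a point over \<open>y\<close> form a nested
  family of intervals, growing without bound. If \<open>g\<close> maps \<open>X\<close> onto \<open>X\<close> and \<open>g x = y\<close>, the family
  of \<open>(f, y)\<close> equals that of \<open>(f \<circ> g, x)\<close>, and up to a bounded error the latter depends only on the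
  homotopy class of \<open>f \<circ> g\<close>. There are countably many classes, so if \<open>X\<close> were continuously
  homogeneous, then, by Baire's theorem, inside a minimal closed set \<open>M\<close> on which \<open>f\<close> is essential
  the family would be constant, up to a bounded error, on a nonempty open set \<open>U\<close>. But \<open>f\<close> is
  inessential on \<open>M - U\<close>, so long continua over \<open>M\<close> return to \<open>U\<close> at arbitrarily distant heights,
  and the family at the return point is the family of the starting point seen from a
  translated sheet: both ends of its long intervals are shifted by the same large amount,
  which contradicts nestedness.
\<close>

section \<open>Continua in metric spaces\<close>

text \<open>By compactness of \<open>K0 - V\<close>, finitely many members already have no common
  point there; in a chain, one member lies inside all of these and inside \<open>K0\<close>.\<close>

lemma chain_Inter_subset_open:
  fixes \<C> :: "'a::t2_space set set"
  assumes "\<C> \<noteq> {}" "\<And>K. K \<in> \<C> \<Longrightarrow> compact K" "\<And>K L. \<lbrakk>K \<in> \<C>; L \<in> \<C>\<rbrakk> \<Longrightarrow> K \<subseteq> L \<or> L \<subseteq> K"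
    and "open V" "\<Inter>\<C> \<subseteq> V"
  obtains K where "K \<in> \<C>" "K \<subseteq> V"
proof -
  obtain K0 where K0: "K0 \<in> \<C>"
    using assms(1) by blast
  have "\<exists>\<F>. finite \<F> \<and> \<F> \<subseteq> \<C> \<and> (K0 - V) \<inter> \<Inter>\<F> = {}"
  proof (rule ccontr)
    assume "\<not> ?thesis"
    then have fip: "(K0 - V) \<inter> \<Inter>\<F> \<noteq> {}" if "finite \<F>" "\<F> \<subseteq> \<C>" for \<F>
      using that by blast
    have "(K0 - V) \<inter> \<Inter>\<C> \<noteq> {}"
      by (rule compact_imp_fip[OF compact_diff[OF assms(2)[OF K0] assms(4)]])
        (simp_all add: compact_imp_closed assms(2) fip)
    then show False
      using assms(5) by blast
  qed
  then obtain \<F> where \<F>: "finite \<F>" "\<F> \<subseteq> \<C>" "(K0 - V) \<inter> \<Inter>\<F> = {}"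
    by blast
  have "\<exists>K\<in>\<C>. K \<subseteq> K0 \<and> K \<subseteq> \<Inter>\<F>"
    using \<F>(1,2)
  proof (induction \<F> rule: finite_induct)
    case empty
    then show ?case using K0 by auto
  next
    case (insert L \<F>)
    then obtain K where "K \<in> \<C>" "K \<subseteq> K0" "K \<subseteq> \<Inter>\<F>"
      by auto
    have "L \<in> \<C>"
      using insert.prems by simp
    with \<open>K \<in> \<C>\<close> consider "K \<subseteq> L" | "L \<subseteq> K"
      using assms(3) by blast
    then show ?case
    proof cases
      case 1
      with \<open>K \<in> \<C>\<close> \<open>K \<subseteq> K0\<close> \<open>K \<subseteq> \<Inter>\<F>\<close> show ?thesis
        by (intro bexI[of _ K]) auto
    next
      case 2
      with \<open>L \<in> \<C>\<close> \<open>K \<subseteq> K0\<close> \<open>K \<subseteq> \<Inter>\<F>\<close> show ?thesis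
        by (intro bexI[of _ L]) auto
    qed
  qed
  with \<F>(3) show thesis
    using that by blast
qed

lemma compact_Inter_t2:
  fixes \<C> :: "'a::t2_space set set"
  assumes "\<C> \<noteq> {}" "\<And>K. K \<in> \<C> \<Longrightarrow> compact K"
  shows "compact (\<Inter>\<C>)"
proof -
  obtain K0 where "K0 \<in> \<C>"
    using assms(1) by blast
  moreover have "closed (\<Inter>\<C>)"
    using assms(2) by (intro closed_Inter) (auto intro: compact_imp_closed)
  ultimately show ?thesis
    using compact_Int_closed[of K0 "\<Inter>\<C>"] assms(2) by (simp add: inf.absorb2 Inter_lower)
qed

text \<open>Disjoint open sets around the two halves of a separation of the intersection would
  cover, and so disconnect, a single member of the chain.\<close>

lemma connected_Inter_chain:
  fixes \<C> :: "'a::metric_space set set"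
  assumes "\<C> \<noteq> {}" "\<And>K. K \<in> \<C> \<Longrightarrow> compact K \<and> connected K"
    and chain: "\<And>K L. \<lbrakk>K \<in> \<C>; L \<in> \<C>\<rbrakk> \<Longrightarrow> K \<subseteq> L \<or> L \<subseteq> K"
  shows "connected (\<Inter>\<C>)"
proof -
  have "closed (\<Inter>\<C>)"
    using assms(2) by (intro closed_Inter) (auto intro: compact_imp_closed)
  moreover have False if AB: "closed A" "closed B" "A \<inter> B = {}" "A \<union> B = \<Inter>\<C>" "A \<noteq> {}" "B \<noteq> {}" for A B
  proof -
    have "normal_space (euclidean :: 'a topology)"
      by (simp add: metrizable_imp_normal_space metrizable_space_euclidean)
    moreover have "closedin euclidean A \<and> closedin euclidean B \<and> disjnt A B"
      using AB by (simp add: disjnt_def)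
    ultimately have "\<exists>U V. openin euclidean U \<and> openin euclidean V \<and> A \<subseteq> U \<and> B \<subseteq> V \<and> disjnt U V"
      unfolding normal_space_def by blast
    then obtain U V where UV: "open U" "open V" "A \<subseteq> U" "B \<subseteq> V" "U \<inter> V = {}"
      by (auto simp: disjnt_def)
    have "\<Inter>\<C> \<subseteq> U \<union> V"
      using UV AB(4) by blast
    moreover have "open (U \<union> V)"
      using UV by blast
    ultimately obtain K where K: "K \<in> \<C>" "K \<subseteq> U \<union> V"
      using chain_Inter_subset_open[OF assms(1) _ chain, of "U \<union> V" thesis] assms(2) by blast
    then have "A \<subseteq> K" "B \<subseteq> K"
      using AB by auto
    then show False
      using connectedD[of K U V] UV K assms(2) AB by blast
  qed
  ultimately show ?thesis
    by (auto simp: connected_closed_set)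
qed

text \<open>Complements turn intersections of nonempty chains into unions, the setting of
  \<open>subset_Zorn_nonempty\<close>.\<close>

lemma Zorn_minimal:
  assumes "\<A> \<noteq> {}"
    and "\<And>\<C>. \<lbrakk>\<C> \<noteq> {}; \<C> \<subseteq> \<A>; \<And>K L. \<lbrakk>K \<in> \<C>; L \<in> \<C>\<rbrakk> \<Longrightarrow> K \<subseteq> L \<or> L \<subseteq> K\<rbrakk> \<Longrightarrow> \<Inter>\<C> \<in> \<A>"
  shows "\<exists>M\<in>\<A>. \<forall>N\<in>\<A>. N \<subseteq> M \<longrightarrow> N = M"
proof -
  have "\<exists>M\<in>uminus ` \<A>. \<forall>X\<in>uminus ` \<A>. M \<subseteq> X \<longrightarrow> X = M"
  proof (rule subset_Zorn_nonempty)
    fix \<C> assume \<C>: "\<C> \<noteq> {}" "subset.chain (uminus ` \<A>) \<C>"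
    then have sub: "uminus ` \<C> \<subseteq> \<A>"
      unfolding subset_chain_def by auto
    moreover have "K \<subseteq> L \<or> L \<subseteq> K" if "K \<in> uminus ` \<C>" "L \<in> uminus ` \<C>" for K L
    proof -
      have "- K \<in> \<C>" "- L \<in> \<C>"
        using that by auto
      then have "- K \<subseteq> - L \<or> - L \<subseteq> - K"
        using \<C>(2) unfolding subset_chain_def by blast
      then show ?thesis
        by blast
    qed
    ultimately have "\<Inter>(uminus ` \<C>) \<in> \<A>"
      using assms(2)[of "uminus ` \<C>"] \<C>(1) by auto
    then have "- \<Inter>(uminus ` \<C>) \<in> uminus ` \<A>"
      by blast
    then show "\<Union>\<C> \<in> uminus ` \<A>"
      by (simp add: image_image)
  qed (use assms(1) in auto)
  then obtain M where M: "M \<in> \<A>" "\<forall>X\<in>\<A>. - M \<subseteq> - X \<longrightarrow> - X = - M"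
    by auto
  have "N = M" if "N \<in> \<A>" "N \<subseteq> M" for N
    using M(2) that by auto
  with M(1) show ?thesis
    by blast
qed

text \<open>In a compact Hausdorff space components are quasi-components; the cut wire fence theorem
  is this fact with a closed set \<open>A\<close> in place of a point.\<close>

lemma connected_component_clopen_separation:
  fixes Z :: "'a::metric_space set"
  assumes "compact Z" "closed A" "z \<in> Z" "connected_component_set Z z \<inter> A = {}"
  obtains W where "openin (top_of_set Z) W" "closedin (top_of_set Z) W" "z \<in> W" "W \<inter> A = {}"
proof -
  have "separated_between (top_of_set Z) {z} (Z \<inter> A)"
  proof (rule cut_wire_fence_theorem)
    show "compact_space (top_of_set Z)"
      using assms(1) by (simp add: compact_space_subtopology)
    show "Hausdorff_space (top_of_set Z)"
      by (simp add: Hausdorff_space_subtopology)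
    show "closedin (top_of_set Z) {z}"
      using assms(3) by simp
    show "closedin (top_of_set Z) (Z \<inter> A)"
      using assms(2) by (simp add: closedin_closed_Int)
    fix C assume C: "connectedin (top_of_set Z) C"
    show "disjnt C {z} \<or> disjnt C (Z \<inter> A)"
    proof (rule disjCI)
      assume meets: "\<not> disjnt C (Z \<inter> A)"
      show "disjnt C {z}"
      proof (rule ccontr)
        assume "\<not> disjnt C {z}"
        then have "z \<in> C"
          by (simp add: disjnt_def)
        moreover have "connected C" "C \<subseteq> Z"
          using C by (simp_all add: connectedin_subtopology)
        ultimately have "C \<subseteq> connected_component_set Z z"
          by (intro connected_component_maximal)
        then show False
          using meets assms(4) unfolding disjnt_def by blast
      qed
    qed
  qed
  then have "\<exists>W. closedin (top_of_set Z) W \<and> openin (top_of_set Z) W \<and> {z} \<subseteq> W \<and> Z \<inter> A \<subseteq> topspace (top_of_set Z) - W"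
    by (rule separated_between[THEN iffD1])
  then obtain W where "closedin (top_of_set Z) W" "openin (top_of_set Z) W" "z \<in> W" "Z \<inter> A \<subseteq> Z - W"
    by auto
  moreover have "W \<subseteq> Z"
    using \<open>openin (top_of_set Z) W\<close> openin_imp_subset by blast
  ultimately show thesis
    using that by blast
qed

text \<open>A clopen set around \<open>z\<close> that misses \<open>A\<close> contains the component
  of each of its points, so missing \<open>A\<close> is an open condition.\<close>

lemma closed_component_meets:
  fixes Z :: "'a::metric_space set"
  assumes "compact Z" "closed A"
  shows "closed {z \<in> Z. connected_component_set Z z \<inter> A \<noteq> {}}"
proof -
  let ?S = "{z \<in> Z. connected_component_set Z z \<inter> A = {}}"
  have "openin (top_of_set Z) ?S"
  proof (subst openin_subopen, intro ballI)
    fix z assume "z \<in> ?S"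
    then obtain W where W: "openin (top_of_set Z) W" "closedin (top_of_set Z) W" "z \<in> W" "W \<inter> A = {}"
      using connected_component_clopen_separation[OF assms, of z] by auto
    have "W \<subseteq> ?S"
    proof
      fix w assume w: "w \<in> W"
      then have wZ: "w \<in> Z"
        using W(1) openin_imp_subset by blast
      let ?C = "connected_component_set Z w"
      have "connectedin (top_of_set Z) ?C"
        by (simp add: connectedin_subtopology connected_component_subset)
      then have "?C \<subseteq> W \<or> disjnt ?C W"
        by (rule connectedin_clopen_cases[OF _ W(2) W(1)])
      moreover have "w \<in> ?C"
        using wZ by simp
      ultimately have "?C \<subseteq> W"
        using w unfolding disjnt_def by blast
      then show "w \<in> ?S"
        using W(4) wZ by auto
    qed
    then show "\<exists>T. openin (top_of_set Z) T \<and> z \<in> T \<and> T \<subseteq> ?S"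
      using W by blast
  qed
  then have "closedin (top_of_set Z) (Z - ?S)"
    by (intro closedin_diff closedin_subtopology_refl[THEN iffD2]) auto
  moreover have "Z - ?S = {z \<in> Z. connected_component_set Z z \<inter> A \<noteq> {}}"
    by auto
  ultimately show ?thesis
    using closedin_closed_trans[of Z] compact_imp_closed[OF assms(1)] by simp
qed

text \<open>Boundary bumping; it serves to contradict the maximality of a component of an
  intersection of two continua.\<close>

lemma continuum_extension:
  fixes C :: "'a::metric_space set"
  assumes "compact C" "connected C" "compact E" "connected E" "E \<noteq> {}" "E \<subset> C"
    and "openin (top_of_set C) V" "E \<subseteq> V"
  obtains E' where "compact E'" "connected E'" "E \<subset> E'" "E' \<subseteq> V"
proof -
  have "connected_space (top_of_set C)"
    using connectedin_iff_connected[of C] assms(2) by (simp only: connectedin_def) blast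
  moreover have "locally_compact_space (top_of_set C)"
    using assms(1) by (simp add: compact_imp_locally_compact_space compact_space_subtopology)
  moreover have "Hausdorff_space (top_of_set C)"
    by (simp add: Hausdorff_space_subtopology)
  moreover have "compactin (top_of_set C) E" "connectedin (top_of_set C) E" "E \<noteq> topspace (top_of_set C)"
    using assms by (auto simp: compactin_subtopology connectedin_subtopology)
  ultimately obtain D where "compactin (top_of_set C) D" "connectedin (top_of_set C) D" "E \<subset> D" "D \<subset> V"
    using intermediate_continuum_exists[of "top_of_set C" E V thesis] assms(5,7,8) by blast
  then show thesis
    using that by (auto simp: compactin_subtopology connectedin_subtopology)
qed

lemma Tietze_real:
  fixes \<phi> :: "'a::metric_space \<Rightarrow> real"
  assumes "closed Z" "continuous_on Z \<phi>"
  obtains \<Phi> where "continuous_on UNIV \<Phi>" "\<And>x. x \<in> Z \<Longrightarrow> \<Phi> x = \<phi> x"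
proof -
  have "normal_space (euclidean :: 'a topology)"
    by (simp add: metrizable_imp_normal_space metrizable_space_euclidean)
  moreover have "closedin euclidean Z"
    using assms(1) by simp
  moreover have "continuous_map (top_of_set Z) euclideanreal \<phi>"
    using assms(2) by simp
  ultimately obtain g where "continuous_map euclidean euclideanreal g" "\<And>x. x \<in> Z \<Longrightarrow> g x = \<phi> x"
    using Tietze_extension_realinterval[of "euclidean :: 'a topology" Z UNIV \<phi> thesis] is_interval_univ
    by blast
  then have "continuous_on UNIV g"
    by (metis continuous_map_iff_continuous2)
  then show thesis
    using that \<open>\<And>x. x \<in> Z \<Longrightarrow> g x = \<phi> x\<close> by blast
qed

section \<open>The pulled back covering\<close>

lemma cis_eq_cis_iff: "cis a = cis b \<longleftrightarrow> (\<exists>k::int. a = b + 2 * pi * of_int k)"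
  by (simp add: complex_eq_iff sin_cos_eq_iff conj_commute[of "cos _ = _"])

lemma cis_eq_cis_close:
  assumes "cis a = cis b" "\<bar>a - b\<bar> < 2 * pi"
  shows "a = b"
proof -
  obtain k :: int where k: "a = b + 2 * pi * of_int k"
    using assms(1) cis_eq_cis_iff by blast
  then have "2 * pi * \<bar>real_of_int k\<bar> < 2 * pi * 1"
    using assms(2) by (simp add: abs_mult)
  then have "\<bar>real_of_int k\<bar> < 1"
    by (simp add: mult_less_cancel_left_pos)
  then show ?thesis
    using k by simp
qed

text \<open>A map into the circle has a real lift exactly when it is null-homotopic; the lifts are
  the sections of the covering \<open>lift_space X f\<close>.\<close>

definition inessential :: "'a::topological_space set \<Rightarrow> ('a \<Rightarrow> complex) \<Rightarrow> bool" where
  "inessential X f \<longleftrightarrow> (\<exists>\<phi>. continuous_on X \<phi> \<and> (\<forall>x\<in>X. f x = cis (\<phi> x)))"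

text \<open>The pullback along \<open>f\<close> of the covering \<open>cis\<close> of the circle:
  \<open>fst\<close> is the projection, \<open>snd\<close> the height, and vertical translations by
  multiples of \<open>2 * pi\<close> are deck transformations.\<close>

definition lift_space :: "'a set \<Rightarrow> ('a \<Rightarrow> complex) \<Rightarrow> ('a \<times> real) set" where
  "lift_space X f = {(x, t). x \<in> X \<and> f x = cis t}"

lemma mem_lift_space: "p \<in> lift_space X f \<longleftrightarrow> fst p \<in> X \<and> f (fst p) = cis (snd p)"
  by (auto simp: lift_space_def)

lemma inessential_subset: "inessential X f \<Longrightarrow> Y \<subseteq> X \<Longrightarrow> inessential Y f"
  unfolding inessential_def by (meson continuous_on_subset subsetD)

lemma lift_space_mono: "M \<subseteq> X \<Longrightarrow> lift_space M f \<subseteq> lift_space X f"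
  by (auto simp: lift_space_def)

text \<open>Where \<open>f\<close> is less than a right angle away from
  \<open>cis (\<psi> x)\<close>, the principal argument of their quotient is continuous and corrects
  \<open>\<psi>\<close> to a lift.\<close>

lemma openin_Re_pos_lift:
  assumes "continuous_on X f" "continuous_on X \<psi>" "\<And>x. x \<in> X \<Longrightarrow> norm (f x) = 1"
  defines "S \<equiv> {x \<in> X. 0 < Re (f x * cis (- \<psi> x))}"
  shows "openin (top_of_set X) S"
    and "continuous_on S (\<lambda>x. \<psi> x + Arg (f x * cis (- \<psi> x)))"
    and "\<And>x. x \<in> S \<Longrightarrow> f x = cis (\<psi> x + Arg (f x * cis (- \<psi> x)))"
proof -
  have cont: "continuous_on X (\<lambda>x. f x * cis (- \<psi> x))"
    using assms(1,2) unfolding cis_conv_exp by (intro continuous_intros)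
  have "S = X \<inter> (\<lambda>x. Re (f x * cis (- \<psi> x))) -` {0<..}"
    by (auto simp: S_def)
  then show "openin (top_of_set X) S"
    using continuous_openin_preimage_gen[OF continuous_on_Re[OF cont], of "{0<..}"] by simp
  have "S \<subseteq> X"
    by (auto simp: S_def)
  then show "continuous_on S (\<lambda>x. \<psi> x + Arg (f x * cis (- \<psi> x)))"
    using continuous_on_subset[OF cont] continuous_on_subset[OF assms(2)]
    by (intro continuous_on_add continuous_on_Arg') (auto simp: S_def complex_nonpos_Reals_iff)
  fix x assume "x \<in> S"
  then have "norm (f x * cis (- \<psi> x)) = 1"
    using assms(3) \<open>S \<subseteq> X\<close> by (auto simp: norm_mult)
  then have "cis (Arg (f x * cis (- \<psi> x))) = f x * cis (- \<psi> x)"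
    by (subst cis_Arg) (auto simp: sgn_div_norm)
  then have "cis (\<psi> x + Arg (f x * cis (- \<psi> x))) = f x * (cis (- \<psi> x) * cis (\<psi> x))"
    by (simp add: cis_mult[symmetric] mult_ac)
  then show "f x = cis (\<psi> x + Arg (f x * cis (- \<psi> x)))"
    by (simp add: cis_mult)
qed

text \<open>Tietze extends the lift beyond \<open>Z\<close>; near \<open>Z\<close> the extension is
  almost a lift, and \<open>openin_Re_pos_lift\<close> repairs it.\<close>

lemma inessential_neighbourhood:
  fixes f :: "'a::metric_space \<Rightarrow> complex"
  assumes "continuous_on X f" "\<And>x. x \<in> X \<Longrightarrow> norm (f x) = 1"
    and "closed Z" "Z \<subseteq> X" "inessential Z f"
  obtains V where "open V" "Z \<subseteq> V" "inessential (X \<inter> V) f"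
proof -
  obtain \<phi> where \<phi>: "continuous_on Z \<phi>" "\<And>x. x \<in> Z \<Longrightarrow> f x = cis (\<phi> x)"
    using assms(5) unfolding inessential_def by blast
  obtain \<psi> where \<psi>: "continuous_on UNIV \<psi>" "\<And>x. x \<in> Z \<Longrightarrow> \<psi> x = \<phi> x"
    using Tietze_real[OF assms(3) \<phi>(1)] by blast
  define S where "S = {x \<in> X. 0 < Re (f x * cis (- \<psi> x))}"
  note S = openin_Re_pos_lift[OF assms(1) continuous_on_subset[OF \<psi>(1) subset_UNIV] assms(2), folded S_def]
  obtain V where V: "open V" "S = X \<inter> V"
    using S(1) by (auto simp: openin_open)
  have "x \<in> S" if "x \<in> Z" for x
    using that assms(4) \<phi>(2) \<psi>(2) by (auto simp: S_def cis_mult)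
  then have "Z \<subseteq> V"
    using V by auto
  moreover have "inessential S f"
    unfolding inessential_def using S(2,3) by blast
  ultimately show thesis
    using that V by simp
qed

lemma closed_lift_space:
  fixes X :: "'a::metric_space set"
  assumes "compact X" "continuous_on X f"
  shows "closed (lift_space X f)"
proof -
  have "continuous_on (X \<times> UNIV) (\<lambda>p. f (fst p) - cis (snd p))"
    unfolding cis_conv_exp
    by (intro continuous_intros continuous_on_compose2[OF assms(2)]) auto
  moreover have "closed (X \<times> (UNIV :: real set))"
    using assms(1) by (simp add: closed_Times compact_imp_closed)
  ultimately have "closed {p \<in> X \<times> UNIV. f (fst p) - cis (snd p) = 0}"
    by (rule continuous_closed_preimage_constant)
  moreover have "{p \<in> X \<times> UNIV. f (fst p) - cis (snd p) = 0} = lift_space X f"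
    by (auto simp: lift_space_def)
  ultimately show ?thesis
    by simp
qed

lemma compact_lift_space_slab:
  fixes X :: "'a::metric_space set"
  assumes "compact X" "continuous_on X f"
  shows "compact (lift_space X f \<inter> UNIV \<times> {a..b})"
proof -
  have "lift_space X f \<inter> UNIV \<times> {a..b} = (X \<times> {a..b}) \<inter> lift_space X f"
    by (auto simp: lift_space_def)
  then show ?thesis
    using closed_lift_space[OF assms] assms(1) by (simp add: compact_Int_closed compact_Times)
qed

lemma compact_inj_fst_graph:
  fixes K :: "('a::metric_space \<times> real) set"
  assumes "compact K" "inj_on fst K"
  obtains \<phi> where "continuous_on (fst ` K) \<phi>" "\<And>p. p \<in> K \<Longrightarrow> \<phi> (fst p) = snd p"
proof
  let ?h = "the_inv_into K fst"
  have "continuous_on (fst ` K) ?h"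
    using assms by (intro continuous_on_inv_into) (auto intro: continuous_intros)
  then show "continuous_on (fst ` K) (\<lambda>x. snd (?h x))"
    by (intro continuous_intros)
  show "snd (?h (fst p)) = snd p" if "p \<in> K" for p
    using the_inv_into_f_f[OF assms(2) that] by simp
qed

lemma compact_inj_fst_imp_inessential:
  fixes K :: "('a::metric_space \<times> real) set"
  assumes "compact K" "K \<subseteq> lift_space X f" "inj_on fst K"
  shows "inessential (fst ` K) f"
proof -
  obtain \<phi> where \<phi>: "continuous_on (fst ` K) \<phi>" "\<And>p. p \<in> K \<Longrightarrow> \<phi> (fst p) = snd p"
    using compact_inj_fst_graph assms(1,3) by blast
  have "f (fst p) = cis (\<phi> (fst p))" if "p \<in> K" for p
    using assms(2) that \<phi>(2) by (auto simp: lift_space_def)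
  with \<phi>(1) show ?thesis
    unfolding inessential_def by blast
qed

text \<open>The covering projection is open because a local section \<open>s\<close> runs through
  each point \<open>(x, t)\<close>.\<close>

lemma openin_fst_image_lift_space:
  fixes f :: "'a::metric_space \<Rightarrow> complex"
  assumes "continuous_on M f" "\<And>x. x \<in> M \<Longrightarrow> norm (f x) = 1"
    and "openin (top_of_set (lift_space M f)) W"
  shows "openin (top_of_set M) (fst ` W)"
proof (subst openin_subopen, intro ballI)
  fix x assume "x \<in> fst ` W"
  then obtain t where xt: "(x, t) \<in> W"
    by auto
  obtain G where G: "open G" "W = lift_space M f \<inter> G"
    using assms(3) by (auto simp: openin_open)
  define S where "S = {y \<in> M. 0 < Re (f y * cis (- t))}"
  define s where "s y = t + Arg (f y * cis (- t))" for y
  note S = openin_Re_pos_lift[OF assms(1) continuous_on_const[of M t] assms(2), folded S_def s_def]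
  have "continuous_on S (\<lambda>y. (y, s y))"
    using S(2) by (intro continuous_intros)
  then have "openin (top_of_set S) (S \<inter> (\<lambda>y. (y, s y)) -` G)"
    using G(1) by (rule continuous_openin_preimage_gen)
  then have "openin (top_of_set M) (S \<inter> (\<lambda>y. (y, s y)) -` G)"
    using S(1) openin_trans by blast
  moreover have fx: "f x = cis t" "x \<in> M"
    using xt G by (auto simp: lift_space_def)
  then have "x \<in> S \<inter> (\<lambda>y. (y, s y)) -` G"
    using xt G by (auto simp: S_def s_def cis_mult)
  moreover have "S \<inter> (\<lambda>y. (y, s y)) -` G \<subseteq> fst ` W"
  proof
    fix y assume y: "y \<in> S \<inter> (\<lambda>y. (y, s y)) -` G"
    then have "y \<in> S" "(y, s y) \<in> G"
      by auto
    moreover have "f y = cis (s y)"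
      using S(3)[OF _ \<open>y \<in> S\<close>] by blast
    moreover have "y \<in> M"
      using \<open>y \<in> S\<close> unfolding S_def by blast
    ultimately have "(y, s y) \<in> W"
      unfolding G(2) lift_space_def by blast
    then show "y \<in> fst ` W"
      by force
  qed
  ultimately show "\<exists>T. openin (top_of_set M) T \<and> x \<in> T \<and> T \<subseteq> fst ` W"
    by blast
qed

text \<open>The projection of \<open>W\<close> is clopen in the connected set \<open>M\<close>,
  hence all of \<open>M\<close>. The highest points of \<open>W\<close> in the fibres then form a
  compact section.\<close>

lemma compact_open_lift_imp_inessential:
  fixes f :: "'a::metric_space \<Rightarrow> complex"
  assumes "connected M" "continuous_on M f" "\<And>x. x \<in> M \<Longrightarrow> norm (f x) = 1"
    and W: "openin (top_of_set (lift_space M f)) W" "compact W" "W \<noteq> {}"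
  shows "inessential M f"
proof -
  let ?H = "lift_space M f"
  have WH: "W \<subseteq> ?H"
    using W(1) openin_imp_subset by blast
  have "openin (top_of_set M) (fst ` W)"
    using openin_fst_image_lift_space assms(2,3) W(1) by blast
  moreover have "fst ` W \<subseteq> M"
    using WH by (auto simp: lift_space_def)
  moreover have "compact (fst ` W)"
    using W(2) by (intro compact_continuous_image continuous_intros)
  ultimately have fstW: "fst ` W = M"
    using assms(1) W(3) unfolding connected_clopen
    by (blast dest: compact_imp_closed intro: closed_subset)
  define sh where "sh k p = (fst p, snd p + 2 * pi * real k)" for k :: nat and p :: "'a \<times> real"
  have sh: "sh k p \<in> ?H \<longleftrightarrow> p \<in> ?H" for k p
  proof -
    have "cis (snd p + 2 * pi * real k) = cis (snd p)"
      unfolding cis_eq_cis_iff by (intro exI[of _ "int k"]) simp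
    then show ?thesis
      by (auto simp: lift_space_def sh_def)
  qed
  \<comment> \<open>Deleting the points that have another point of \<open>W\<close> above them leaves one sheet.\<close>
  define D where "D = (\<Union>k\<in>{1..}. ?H \<inter> sh k -` W)"
  have "openin (top_of_set ?H) (?H \<inter> sh k -` W)" for k
  proof (rule continuous_openin_preimage[OF _ _ W(1)])
    show "continuous_on ?H (sh k)"
      unfolding sh_def by (intro continuous_intros)
    show "sh k \<in> ?H \<rightarrow> ?H"
      using sh by auto
  qed
  then have "openin (top_of_set ?H) D"
    unfolding D_def by (intro openin_Union) auto
  then obtain G where G: "open G" "D = ?H \<inter> G"
    by (auto simp: openin_open)
  have "W - D = W - G"
    using WH G by auto
  then have "compact (W - D)"
    using W(2) G(1) by (simp add: compact_diff)
  moreover have "inj_on fst (W - D)"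
  proof -
    have False if "(x, s) \<in> W - D" "(x, t) \<in> W" "s < t" for x s t
    proof -
      have "(x, s) \<in> ?H" "(x, t) \<in> ?H"
        using that WH by auto
      then have "cis t = cis s"
        by (simp add: lift_space_def)
      then obtain k :: int where k: "t = s + 2 * pi * of_int k"
        using cis_eq_cis_iff by blast
      then have "0 < 2 * pi * real_of_int k"
        using that(3) by simp
      then have "0 < k"
        by (simp add: zero_less_mult_iff)
      then have "sh (nat k) (x, s) = (x, t)" "nat k \<ge> 1"
        using k by (auto simp: sh_def)
      then have "(x, s) \<in> D"
        unfolding D_def using that(2) \<open>(x, s) \<in> ?H\<close> by (intro UN_I[of "nat k"]) auto
      then show False
        using that(1) by blast
    qed
    then have "s = t" if "(x, s) \<in> W - D" "(x, t) \<in> W - D" for x s t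
      using that linorder_less_linear[of s t] by blast
    then show ?thesis
      by (auto simp: inj_on_def)
  qed
  ultimately have "inessential (fst ` (W - D)) f"
    using compact_inj_fst_imp_inessential[of "W - D" M f] WH by auto
  moreover have "M \<subseteq> fst ` (W - D)"
  proof
    fix x assume "x \<in> M"
    \<comment> \<open>The part of \<open>W\<close> over \<open>x\<close> is compact, so it has a
      highest point; nothing of \<open>W\<close> lies above it, and it survives the
      deletion.\<close>
    let ?F = "snd ` (W \<inter> {x} \<times> UNIV)"
    have "compact ?F"
      using W(2) by (intro compact_continuous_image continuous_intros compact_Int_closed closed_Times) auto
    moreover have "?F \<noteq> {}"
      using fstW \<open>x \<in> M\<close> by auto
    ultimately obtain t where t: "t \<in> ?F" "\<forall>s\<in>?F. s \<le> t"
      using compact_attains_sup by blast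
    then have "(x, t) \<in> W"
      by auto
    moreover have "(x, t) \<notin> D"
    proof
      assume "(x, t) \<in> D"
      then obtain k where k: "k \<ge> 1" "(x, t + 2 * pi * real k) \<in> W"
        by (auto simp: D_def sh_def)
      then have "t + 2 * pi * real k \<in> ?F"
        by force
      then have "t + 2 * pi * real k \<le> t"
        using t(2) by blast
      then have "2 * pi * real k \<le> 0"
        by simp
      then show False
        using k(1) pi_gt_zero by (simp add: mult_le_0_iff)
    qed
    ultimately show "x \<in> fst ` (W - D)"
      by force
  qed
  ultimately show ?thesis
    by (rule inessential_subset)
qed

text \<open>If the component of \<open>z\<close> in the slab missed both faces, a clopen piece of
  the slab around \<open>z\<close> would miss them too. Away from the faces it would be open in the
  whole covering space, and compact, making \<open>f\<close> inessential.\<close>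

lemma lift_space_continuum_to_boundary:
  fixes f :: "'a::metric_space \<Rightarrow> complex"
  assumes "compact M" "connected M" "continuous_on M f" "\<And>x. x \<in> M \<Longrightarrow> norm (f x) = 1"
    and "\<not> inessential M f" "z \<in> lift_space M f" "a \<le> snd z" "snd z \<le> b"
  obtains K where "compact K" "connected K" "K \<subseteq> lift_space M f" "z \<in> K" "snd ` K \<subseteq> {a..b}"
    "a \<in> snd ` K \<or> b \<in> snd ` K"
proof -
  let ?Z = "lift_space M f \<inter> UNIV \<times> {a..b}"
  let ?C = "connected_component_set ?Z z"
  have Z: "compact ?Z" "z \<in> ?Z"
    using compact_lift_space_slab[OF assms(1,3)] assms(6-8) by (auto simp: mem_Times_iff)
  have "?C \<inter> UNIV \<times> {a, b} \<noteq> {}"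
  proof
    assume "?C \<inter> UNIV \<times> {a, b} = {}"
    then obtain W where W: "openin (top_of_set ?Z) W" "closedin (top_of_set ?Z) W" "z \<in> W" "W \<inter> UNIV \<times> {a, b} = {}"
      using connected_component_clopen_separation[OF Z(1) closed_Times[OF closed_UNIV finite_imp_closed] Z(2), of "{a, b}"]
      by blast
    obtain G where G: "open G" "W = ?Z \<inter> G"
      using W(1) by (auto simp: openin_open)
    have "w \<in> UNIV \<times> {a<..<b}" if "w \<in> W" for w
    proof -
      have "w \<notin> UNIV \<times> {a, b}" "w \<in> UNIV \<times> {a..b}"
        using that G(2) W(4) by blast+
      then show ?thesis
        by (auto simp: mem_Times_iff less_le)
    qed
    then have "W = lift_space M f \<inter> (G \<inter> UNIV \<times> {a<..<b})"
      using G(2) by fastforce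
    moreover have "open (G \<inter> UNIV \<times> {a<..<b})"
      using G(1) by (intro open_Int open_Times) auto
    ultimately have "openin (top_of_set (lift_space M f)) W"
      by (auto simp: openin_open)
    moreover have "compact W"
      using W(2) Z(1) closedin_compact by blast
    ultimately show False
      using compact_open_lift_imp_inessential[OF assms(2-4)] W(3) assms(5) by blast
  qed
  then have "a \<in> snd ` ?C \<or> b \<in> snd ` ?C"
    by (force simp: mem_Times_iff)
  moreover have "compact ?C"
    using closed_connected_component[OF compact_imp_closed[OF Z(1)]] connected_component_subset[of ?Z z]
    by (metis Z(1) compact_Int_closed inf.absorb2)
  moreover have "?C \<subseteq> ?Z"
    by (rule connected_component_subset)
  then have "?C \<subseteq> lift_space M f" "snd ` ?C \<subseteq> {a..b}"
    by (auto simp: mem_Times_iff)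
  moreover have "z \<in> ?C"
    using Z(2) by simp
  ultimately show thesis
    using that[of ?C] by simp
qed

section \<open>Hereditary indecomposability of the covering space\<close>

text \<open>Two continua that meet decompose their union.\<close>

lemma hereditarily_indecomposable_nested:
  assumes "hereditarily_indecomposable X" "continuum K" "continuum L" "K \<subseteq> X" "L \<subseteq> X" "K \<inter> L \<noteq> {}"
  shows "K \<subseteq> L \<or> L \<subseteq> K"
proof -
  have "continuum (K \<union> L)"
    using assms unfolding continuum_def by (auto intro: compact_Un connected_Un)
  then have "indecomposable (K \<union> L)"
    using assms unfolding hereditarily_indecomposable_def by blast
  then have "K = K \<union> L \<or> L = K \<union> L"
    using assms(2,3) unfolding indecomposable_def by blast
  then show ?thesis
    by blast
qed

text \<open>If \<open>C\<close> and \<open>D\<close> are not nested, a component of \<open>C \<inter> D\<close> can be enlarged inside each of them within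
  a neighbourhood on which \<open>fst\<close> is injective; the projections of the enlargements are nested in \<open>X\<close>.\<close>

lemma lift_continua_nested_if_inj:
  fixes X :: "'a::metric_space set"
  assumes "hereditarily_indecomposable X"
    and C: "compact C" "connected C" "C \<subseteq> lift_space X f"
    and D: "compact D" "connected D" "D \<subseteq> lift_space X f"
    and z: "z \<in> C \<inter> D"
    and inj: "inj_on fst (connected_component_set (C \<inter> D) z)"
  shows "C \<subseteq> D \<or> D \<subseteq> C"
proof (rule ccontr)
  assume neg: "\<not> (C \<subseteq> D \<or> D \<subseteq> C)"
  define E where "E = connected_component_set (C \<inter> D) z"
  have sub: "E \<subseteq> C" "E \<subseteq> D"
    unfolding E_def using connected_component_subset by blast+
  have "closed E"
    unfolding E_def using C(1) D(1) by (intro closed_connected_component closed_Int compact_imp_closed)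
  then have E: "compact E" "connected E" "z \<in> E"
    using C(1) sub(1) z unfolding E_def
    by (auto simp: compact_Int_closed inf.absorb2 dest: compact_Int_closed[of C])
  obtain \<phi> where \<phi>: "continuous_on (fst ` E) \<phi>" "\<And>p. p \<in> E \<Longrightarrow> \<phi> (fst p) = snd p"
    using compact_inj_fst_graph E(1) inj unfolding E_def by blast
  have "closed (fst ` E)"
    using E(1) by (intro compact_imp_closed compact_continuous_image continuous_intros)
  then obtain \<psi> where \<psi>: "continuous_on UNIV \<psi>" "\<And>x. x \<in> fst ` E \<Longrightarrow> \<psi> x = \<phi> x"
    using Tietze_real \<phi>(1) by blast
  have \<psi>E: "\<psi> (fst p) = snd p" if "p \<in> E" for p
    using that \<phi>(2) \<psi>(2) by simp
  \<comment> \<open>The tolerance \<open>pi\<close> keeps points over one base point less than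
    \<open>2 * pi\<close> apart, so that they coincide, even if one lies in \<open>C\<close> and the
    other in \<open>D\<close>.\<close>
  define V where "V S = S \<inter> (\<lambda>p. \<bar>snd p - \<psi> (fst p)\<bar>) -` {..<pi}" for S
  have "openin (top_of_set S) (V S)" for S
    unfolding V_def
    by (intro continuous_openin_preimage_gen continuous_intros continuous_on_compose2[OF \<psi>(1)]) auto
  moreover have "E \<subseteq> V S" if "E \<subseteq> S" for S
    using that \<psi>E by (auto simp: V_def)
  ultimately have ext: "\<exists>E'. compact E' \<and> connected E' \<and> E \<subset> E' \<and> E' \<subseteq> V S"
    if "compact S" "connected S" "E \<subset> S" for S
    using continuum_extension[of S E "V S" thesis] that E by (metis continuum_extension empty_iff psubset_imp_subset)
  have "E \<noteq> C" "E \<noteq> D"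
    using neg sub by auto
  then obtain C' D' where C': "compact C'" "connected C'" "E \<subset> C'" "C' \<subseteq> V C"
    and D': "compact D'" "connected D'" "E \<subset> D'" "D' \<subseteq> V D"
    using ext[of C] ext[of D] C D sub by blast
  have max: "S \<subseteq> E" if "S \<subseteq> C \<inter> D" "connected S" "E \<subset> S" for S
    unfolding E_def using that E(3) by (intro connected_component_maximal) auto
  have collapse: "c = d" if "c \<in> V C" "d \<in> V D" "fst c = fst d" for c d
  proof -
    have "cis (snd c) = cis (snd d)"
      using that C(3) D(3) by (metis IntE V_def mem_lift_space subsetD)
    moreover have "\<bar>snd c - snd d\<bar> < 2 * pi"
      using that unfolding V_def by (simp add: abs_less_iff)
    ultimately have "snd c = snd d"
      by (rule cis_eq_cis_close)
    then show ?thesis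
      using that(3) by (simp add: prod_eq_iff)
  qed
  have cont: "continuum (fst ` C')" "continuum (fst ` D')"
    using C' D' unfolding continuum_def
    by (auto intro!: compact_continuous_image connected_continuous_image continuous_intros)
  have subX: "fst ` C' \<subseteq> X" "fst ` D' \<subseteq> X"
    using C'(4) D'(4) C(3) D(3) by (auto simp: V_def lift_space_def)
  have "fst z \<in> fst ` C' \<inter> fst ` D'"
    using C'(3) D'(3) E(3) by blast
  \<comment> \<open>Nested projections thus force nested enlargements; the smaller one lies in
    \<open>C \<inter> D\<close> and properly contains the component \<open>E\<close>.\<close>
  then consider "fst ` C' \<subseteq> fst ` D'" | "fst ` D' \<subseteq> fst ` C'"
    using hereditarily_indecomposable_nested[OF assms(1) cont subX] by blast
  then show False
  proof cases
    case 1
    have "C' \<subseteq> D'"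
    proof
      fix c assume c: "c \<in> C'"
      then obtain d where "d \<in> D'" "fst c = fst d"
        using 1 by (metis image_iff subsetD imageI)
      then show "c \<in> D'"
        using collapse c C'(4) D'(4) by blast
    qed
    then have "C' \<subseteq> C \<inter> D"
      using C'(4) D'(4) by (auto simp: V_def)
    then show False
      using max C' by blast
  next
    case 2
    have "D' \<subseteq> C'"
    proof
      fix d assume d: "d \<in> D'"
      then obtain c where "c \<in> C'" "fst c = fst d"
        using 2 by (metis image_iff subsetD imageI)
      then show "d \<in> C'"
        using collapse d C'(4) D'(4) by blast
    qed
    then have "D' \<subseteq> C \<inter> D"
      using C'(4) D'(4) by (auto simp: V_def)
    then show False
      using max D' by blast
  qed
qed

text \<open>A minimal counterexample \<open>M\<close> meets one of its translates \<open>N\<close>, and a component of \<open>M \<inter> N\<close> is a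
  smaller counterexample.\<close>

lemma inj_on_fst_lift_continuum:
  fixes X :: "'a::metric_space set"
  assumes HI: "hereditarily_indecomposable X"
    and K: "compact K" "connected K" "K \<subseteq> lift_space X f"
  shows "inj_on fst K"
proof (rule ccontr)
  assume neg: "\<not> inj_on fst K"
  define \<A> where "\<A> = {E. compact E \<and> connected E \<and> E \<subseteq> lift_space X f \<and> \<not> inj_on fst E}"
  have "\<A> \<noteq> {}"
    using K neg by (auto simp: \<A>_def)
  moreover have "\<Inter>\<C> \<in> \<A>" if \<C>: "\<C> \<noteq> {}" "\<C> \<subseteq> \<A>"
    and chain: "\<And>K L. \<lbrakk>K \<in> \<C>; L \<in> \<C>\<rbrakk> \<Longrightarrow> K \<subseteq> L \<or> L \<subseteq> K" for \<C>
  proof -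
    have mem: "compact E \<and> connected E \<and> E \<subseteq> lift_space X f \<and> \<not> inj_on fst E" if "E \<in> \<C>" for E
      using \<C>(2) that by (auto simp: \<A>_def)
    have comp: "compact (\<Inter>\<C>)"
      using compact_Inter_t2[OF \<C>(1)] mem by blast
    moreover have "connected (\<Inter>\<C>)"
      using connected_Inter_chain[OF \<C>(1) _ chain] mem by blast
    moreover have sub: "\<Inter>\<C> \<subseteq> lift_space X f"
      using \<C>(1) mem by blast
    \<comment> \<open>An injective intersection would be a graph. Within height \<open>pi\<close> of
      a continuous extension of it, no two points of the covering space share a base point, and some
      member of the chain lies that close.\<close>
    moreover have "\<not> inj_on fst (\<Inter>\<C>)"
    proof
      assume "inj_on fst (\<Inter>\<C>)"
      then obtain \<phi> where \<phi>: "continuous_on (fst ` \<Inter>\<C>) \<phi>" "\<And>p. p \<in> \<Inter>\<C> \<Longrightarrow> \<phi> (fst p) = snd p"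
        using compact_inj_fst_graph comp by blast
      have "closed (fst ` \<Inter>\<C>)"
        using comp by (intro compact_imp_closed compact_continuous_image continuous_intros)
      then obtain \<psi> where \<psi>: "continuous_on UNIV \<psi>" "\<And>x. x \<in> fst ` \<Inter>\<C> \<Longrightarrow> \<psi> x = \<phi> x"
        using Tietze_real \<phi>(1) by blast
      let ?V = "{p. \<bar>snd p - \<psi> (fst p)\<bar> < pi}"
      have "open ?V"
        by (intro open_Collect_less continuous_intros continuous_on_compose2[OF \<psi>(1)]) auto
      moreover have "\<psi> (fst p) = snd p" if "p \<in> \<Inter>\<C>" for p
        using that \<phi>(2) \<psi>(2) by (metis imageI)
      then have "\<Inter>\<C> \<subseteq> ?V"
        by (auto simp del: Inter_iff)
      ultimately obtain E where E: "E \<in> \<C>" "E \<subseteq> ?V"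
        using chain_Inter_subset_open[OF \<C>(1) _ chain, of ?V thesis] mem by blast
      have "inj_on fst E"
      proof (rule inj_onI)
        fix c d assume cd: "c \<in> E" "d \<in> E" "fst c = fst d"
        then have "cis (snd c) = cis (snd d)"
          using mem[OF E(1)] by (metis mem_lift_space subsetD)
        moreover have "c \<in> ?V" "d \<in> ?V"
          using cd(1,2) E(2) by blast+
        then have "\<bar>snd c - snd d\<bar> < 2 * pi"
          using cd(3) by (simp add: abs_less_iff)
        ultimately show "c = d"
          using cis_eq_cis_close cd(3) by (metis prod_eq_iff)
      qed
      then show False
        using mem[OF E(1)] by blast
    qed
    ultimately show ?thesis
      by (simp add: \<A>_def)
  qed
  ultimately have "\<exists>M\<in>\<A>. \<forall>N\<in>\<A>. N \<subseteq> M \<longrightarrow> N = M"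
    by (rule Zorn_minimal)
  then obtain M where "M \<in> \<A>" and min: "\<forall>N\<in>\<A>. N \<subseteq> M \<longrightarrow> N = M"
    by blast
  then have M: "compact M" "connected M" "M \<subseteq> lift_space X f" "\<not> inj_on fst M"
    by (auto simp: \<A>_def)
  obtain x s t where st: "(x, s) \<in> M" "(x, t) \<in> M" "s \<noteq> t"
    using M(4) unfolding inj_on_def by (metis prod.collapse)
  \<comment> \<open>Translation by the period \<open>t - s\<close> of \<open>cis\<close> carries
    \<open>(x, s)\<close> to \<open>(x, t)\<close>, so \<open>N\<close> is a continuum in the
    covering space that meets \<open>M\<close>.\<close>
  define N where "N = (\<lambda>p. (fst p, snd p + (t - s))) ` M"
  have cis: "cis (r + (t - s)) = cis r" for r
  proof -
    have "cis t = cis s"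
      using st M(3) by (metis mem_lift_space fst_conv snd_conv subsetD)
    then have "cis (t - s) = 1"
      by (simp add: cis_divide[symmetric])
    then show ?thesis
      by (simp add: cis_mult[symmetric])
  qed
  have N: "compact N" "connected N" "N \<subseteq> lift_space X f"
    unfolding N_def using M cis
    by (auto intro!: compact_continuous_image connected_continuous_image continuous_intros simp: lift_space_def)
  have "(x, t) \<in> N"
    unfolding N_def using st(1) by (intro image_eqI[of _ _ "(x, s)"]) auto
  then have z: "(x, t) \<in> M \<inter> N"
    using st(2) by blast
  have "compact (snd ` M)" "snd ` M \<noteq> {}"
    using M(1) st by (auto intro!: compact_continuous_image continuous_intros)
  then obtain lo hi where bounds: "lo \<in> snd ` M" "\<And>r. r \<in> snd ` M \<Longrightarrow> lo \<le> r"
    "hi \<in> snd ` M" "\<And>r. r \<in> snd ` M \<Longrightarrow> r \<le> hi"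
    using compact_attains_inf compact_attains_sup by metis
  have sndN: "snd ` N = (\<lambda>r. r + (t - s)) ` (snd ` M)"
    unfolding N_def by (auto simp: image_image)
  \<comment> \<open>A nonzero translation moves the lowest and the highest point the same way, so
    neither height range contains the other.\<close>
  have "\<not> N \<subseteq> M" "\<not> M \<subseteq> N"
  proof -
    have mem: "lo + (t - s) \<in> snd ` N" "hi + (t - s) \<in> snd ` N"
      using bounds sndN by auto
    show "\<not> N \<subseteq> M"
    proof
      assume "N \<subseteq> M"
      then have "snd ` N \<subseteq> snd ` M"
        by blast
      with mem have "lo + (t - s) \<in> snd ` M" "hi + (t - s) \<in> snd ` M"
        by blast+
      then show False
        using bounds(2)[of "lo + (t - s)"] bounds(4)[of "hi + (t - s)"] st(3) by linarith
    qed
    show "\<not> M \<subseteq> N"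
    proof
      assume "M \<subseteq> N"
      then have "lo \<in> snd ` N" "hi \<in> snd ` N"
        using bounds by auto
      then obtain r r' where "r \<in> snd ` M" "lo = r + (t - s)" "r' \<in> snd ` M" "hi = r' + (t - s)"
        unfolding sndN by auto
      then show False
        using bounds(2)[of r] bounds(4)[of r'] st(3) by simp
    qed
  qed
  then have nonnested: "\<not> (M \<subseteq> N \<or> N \<subseteq> M)"
    by blast
  \<comment> \<open>If this component projected injectively, \<open>M\<close> and \<open>N\<close>
    would be nested. So it is a counterexample, and minimality gives \<open>G = M\<close>, which
    puts \<open>M\<close> inside \<open>N\<close>.\<close>
  define G where "G = connected_component_set (M \<inter> N) (x, t)"
  have "\<not> inj_on fst G"
    using lift_continua_nested_if_inj[OF HI M(1-3) N z] nonnested unfolding G_def by blast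
  moreover have GMN: "G \<subseteq> M \<inter> N"
    unfolding G_def by (rule connected_component_subset)
  moreover have "closed G"
    unfolding G_def using M(1) N(1) by (intro closed_connected_component closed_Int compact_imp_closed)
  then have "compact G"
    using M(1) GMN by (metis compact_Int_closed inf.absorb2 le_infE)
  moreover have "connected G"
    unfolding G_def by simp
  ultimately have "G \<in> \<A>"
    using M(3) by (auto simp: \<A>_def)
  then have "G = M"
    using min GMN by blast
  then show False
    using GMN nonnested by blast
qed

text \<open>Every continuum in the covering space projects injectively, hence so does a component of
  \<open>C \<inter> D\<close>.\<close>

lemma lift_continua_nested:
  fixes X :: "'a::metric_space set"
  assumes "hereditarily_indecomposable X"
    and "compact C" "connected C" "C \<subseteq> lift_space X f"
    and "compact D" "connected D" "D \<subseteq> lift_space X f"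
    and "C \<inter> D \<noteq> {}"
  shows "C \<subseteq> D \<or> D \<subseteq> C"
proof -
  obtain z where z: "z \<in> C \<inter> D"
    using assms(8) by blast
  have "inj_on fst C"
    using inj_on_fst_lift_continuum assms(1-4) by blast
  then have "inj_on fst (connected_component_set (C \<inter> D) z)"
    by (rule inj_on_subset) (use connected_component_subset in blast)
  then show ?thesis
    using lift_continua_nested_if_inj assms(1-7) z by blast
qed

section \<open>Essential maps and homotopy classes\<close>

text \<open>A lift \<open>\<phi>\<close> of \<open>f \<circ> g\<close> makes the points
  \<open>(g x, \<phi> x)\<close> a continuum in the covering space of \<open>f\<close> that projects
  onto \<open>X\<close>. The projection is injective on it, so this continuum is the graph of a lift
  of \<open>f\<close>.\<close>

lemma essential_comp_surjection:
  fixes X :: "'a::metric_space set"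
  assumes "hereditarily_indecomposable X" "continuum X"
    and "continuous_on X g" "g ` X = X" "\<not> inessential X f"
  shows "\<not> inessential X (f \<circ> g)"
proof
  assume "inessential X (f \<circ> g)"
  then obtain \<phi> where \<phi>: "continuous_on X \<phi>" "\<And>x. x \<in> X \<Longrightarrow> f (g x) = cis (\<phi> x)"
    unfolding inessential_def by auto
  define K where "K = (\<lambda>x. (g x, \<phi> x)) ` X"
  have "continuous_on X (\<lambda>x. (g x, \<phi> x))"
    using assms(3) \<phi>(1) by (intro continuous_intros)
  then have K: "compact K" "connected K"
    using assms(2) unfolding K_def continuum_def
    by (auto intro: compact_continuous_image connected_continuous_image)
  have "K \<subseteq> lift_space X f"
    using assms(4) \<phi>(2) by (auto simp: K_def lift_space_def)
  then have "inessential (fst ` K) f"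
    using K assms(1) compact_inj_fst_imp_inessential inj_on_fst_lift_continuum by blast
  moreover have "fst ` K = X"
    using assms(4) by (simp add: K_def image_image)
  ultimately show False
    using assms(5) by simp
qed

text \<open>Zorn applies because inessentiality spreads to a neighbourhood, hence from the
  intersection of a chain to a member. A minimal set is connected because lifts on two disjoint
  closed pieces can be pasted.\<close>

lemma minimal_essential_subset:
  fixes X :: "'a::metric_space set"
  assumes "compact X" "continuous_on X f" "\<And>x. x \<in> X \<Longrightarrow> norm (f x) = 1" "\<not> inessential X f"
  obtains M where "compact M" "connected M" "M \<subseteq> X" "\<not> inessential M f"
    "\<And>N. \<lbrakk>compact N; N \<subset> M\<rbrakk> \<Longrightarrow> inessential N f"
proof -
  define \<A> where "\<A> = {M. compact M \<and> M \<subseteq> X \<and> \<not> inessential M f}"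
  have "\<A> \<noteq> {}"
    using assms by (auto simp: \<A>_def)
  moreover have "\<Inter>\<C> \<in> \<A>" if \<C>: "\<C> \<noteq> {}" "\<C> \<subseteq> \<A>"
    and chain: "\<And>K L. \<lbrakk>K \<in> \<C>; L \<in> \<C>\<rbrakk> \<Longrightarrow> K \<subseteq> L \<or> L \<subseteq> K" for \<C>
  proof -
    have mem: "compact E \<and> E \<subseteq> X \<and> \<not> inessential E f" if "E \<in> \<C>" for E
      using \<C>(2) that by (auto simp: \<A>_def)
    have comp: "compact (\<Inter>\<C>)"
      using compact_Inter_t2[OF \<C>(1)] mem by blast
    moreover have sub: "\<Inter>\<C> \<subseteq> X"
      using \<C>(1) mem by blast
    moreover have "\<not> inessential (\<Inter>\<C>) f"
    proof
      assume iness: "inessential (\<Inter>\<C>) f"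
      obtain V where V: "open V" "\<Inter>\<C> \<subseteq> V" "inessential (X \<inter> V) f"
        using inessential_neighbourhood[OF assms(2,3) compact_imp_closed[OF comp] sub iness] by blast
      then obtain E where "E \<in> \<C>" "E \<subseteq> V"
        using chain_Inter_subset_open[OF \<C>(1) _ chain, of V thesis] mem by blast
      then show False
        using mem[of E] inessential_subset[OF V(3), of E] by blast
    qed
    ultimately show ?thesis
      by (simp add: \<A>_def)
  qed
  ultimately have "\<exists>M\<in>\<A>. \<forall>N\<in>\<A>. N \<subseteq> M \<longrightarrow> N = M"
    by (rule Zorn_minimal)
  then obtain M where "M \<in> \<A>" and min: "\<forall>N\<in>\<A>. N \<subseteq> M \<longrightarrow> N = M"
    by blast
  then have M: "compact M" "M \<subseteq> X" "\<not> inessential M f"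
    by (auto simp: \<A>_def)
  have proper: "inessential N f" if "compact N" "N \<subset> M" for N
    using min that M(2) unfolding \<A>_def by blast
  have "connected M"
  proof (rule ccontr)
    assume "\<not> connected M"
    then obtain A B where AB: "closed A" "closed B" "A \<noteq> {}" "B \<noteq> {}" "A \<union> B = M" "A \<inter> B = {}"
      using connected_closed_set[OF compact_imp_closed[OF M(1)]] by blast
    then have "compact A" "compact B" "A \<subset> M" "B \<subset> M"
      using closed_Int_compact[of A M] closed_Int_compact[of B M] M(1) by (auto simp: inf.absorb1)
    then obtain \<phi> \<theta> where lifts: "continuous_on A \<phi>" "\<And>x. x \<in> A \<Longrightarrow> f x = cis (\<phi> x)"
      "continuous_on B \<theta>" "\<And>x. x \<in> B \<Longrightarrow> f x = cis (\<theta> x)"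
      using proper unfolding inessential_def by meson
    then have "continuous_on (A \<union> B) (\<lambda>x. if x \<in> A then \<phi> x else \<theta> x)"
      using AB by (intro continuous_on_cases) auto
    moreover have "f x = cis (if x \<in> A then \<phi> x else \<theta> x)" if "x \<in> A \<union> B" for x
      using that lifts(2,4) by (metis UnE)
    ultimately have "inessential (A \<union> B) f"
      unfolding inessential_def by blast
    then show False
      using AB M(3) by simp
  qed
  then show thesis
    using that M proper by blast
qed

text \<open>The code of a map records the scale of a finite net on which the map is sampled,
  and the sampled values up to \<open>1/8\<close>; so there are only countably many homotopy classes.\<close>

lemma circle_map_code:
  fixes X :: "'a::metric_space set"
  assumes "compact X"
  obtains code :: "('a \<Rightarrow> complex) \<Rightarrow> nat \<times> (int \<times> int) list"
  where "\<And>u v. \<lbrakk>continuous_on X u; continuous_on X v; \<And>x. x \<in> X \<Longrightarrow> norm (u x) = 1;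
      \<And>x. x \<in> X \<Longrightarrow> norm (v x) = 1; code u = code v\<rbrakk>
    \<Longrightarrow> \<exists>h. continuous_on X h \<and> (\<forall>x\<in>X. \<bar>h x\<bar> \<le> pi \<and> v x = u x * cis (h x))"
proof -
  have "\<exists>F. set F \<subseteq> X \<and> X \<subseteq> (\<Union>d\<in>set F. ball d (1 / real (Suc n)))" for n
  proof -
    obtain D where "finite D" "D \<subseteq> X" "X \<subseteq> (\<Union>d\<in>D. ball d (1 / real (Suc n)))"
      using assms compact_imp_seq_compact seq_compact_imp_totally_bounded
      by (metis of_nat_0_less_iff zero_less_Suc zero_less_divide_1_iff)
    then show ?thesis
      using finite_list by metis
  qed
  then obtain F where F: "\<And>n. set (F n) \<subseteq> X"
      "\<And>n. X \<subseteq> (\<Union>d\<in>set (F n). ball d (1 / real (Suc n)))"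
    by metis
  define sampled where
    "sampled u n \<longleftrightarrow> (\<forall>x\<in>X. \<forall>d\<in>X. dist d x < 1 / real (Suc n) \<longrightarrow> norm (u x - u d) < 1 / 8)" for u :: "'a \<Rightarrow> complex" and n
  have ex_sampled: "\<exists>n. sampled u n" if u: "continuous_on X u" for u
  proof -
    have "uniformly_continuous_on X u"
      using assms u compact_uniformly_continuous by blast
    then obtain \<delta> where \<delta>: "\<delta> > 0" "\<And>x d. \<lbrakk>x \<in> X; d \<in> X; dist d x < \<delta>\<rbrakk> \<Longrightarrow> dist (u d) (u x) < 1 / 8"
      unfolding uniformly_continuous_on_def by (metis zero_less_divide_1_iff zero_less_numeral)
    obtain n where "inverse (real (Suc n)) < \<delta>"
      using reals_Archimedean \<delta>(1) by blast
    then have "sampled u n"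
      using \<delta>(2) by (force simp: sampled_def dist_norm norm_minus_commute inverse_eq_divide)
    then show ?thesis ..
  qed
  define N where "N u = (SOME n. sampled u n)" for u
  have N: "sampled u (N u)" if "continuous_on X u" for u
    unfolding N_def using ex_sampled[OF that] by (rule someI_ex)
  define code where "code u = (N u, map (\<lambda>d. (\<lfloor>8 * Re (u d)\<rfloor>, \<lfloor>8 * Im (u d)\<rfloor>)) (F (N u)))"
    for u :: "'a \<Rightarrow> complex"
  show thesis
  proof
    fix u v :: "'a \<Rightarrow> complex"
    assume u: "continuous_on X u" "\<And>x. x \<in> X \<Longrightarrow> norm (u x) = 1"
      and v: "continuous_on X v" "\<And>x. x \<in> X \<Longrightarrow> norm (v x) = 1"
      and eq: "code u = code v"
    have Neq: "N v = N u"
      and samples: "\<And>d. d \<in> set (F (N u)) \<Longrightarrow> \<lfloor>8 * Re (u d)\<rfloor> = \<lfloor>8 * Re (v d)\<rfloor> \<and> \<lfloor>8 * Im (u d)\<rfloor> = \<lfloor>8 * Im (v d)\<rfloor>"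
      using eq by (auto simp: code_def)
    \<comment> \<open>Equal floors bound each coordinate difference at a net point by
      \<open>1/8\<close>, so the maps differ there by less than \<open>1/4\<close>; passing to
      \<open>x\<close> costs \<open>1/8\<close> for each map.\<close>
    have close: "norm (v x - u x) < 1 / 2" if x: "x \<in> X" for x
    proof -
      obtain d where d: "d \<in> set (F (N u))" "dist d x < 1 / real (Suc (N u))"
        using F(2)[of "N u"] x by auto
      then have dX: "d \<in> X"
        using F(1) by blast
      have "norm (u x - u d) < 1 / 8" "norm (v x - v d) < 1 / 8"
        using N[OF u(1)] N[OF v(1)] x dX d(2) unfolding sampled_def Neq by blast+
      moreover have "\<bar>Re (v d - u d)\<bar> < 1 / 8" "\<bar>Im (v d - u d)\<bar> < 1 / 8"
        using samples[OF d(1)] unfolding minus_complex.sel by linarith+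
      then have "norm (v d - u d) < 1 / 4"
        using cmod_le[of "v d - u d"] by linarith
      moreover have "norm (v x - u x) \<le> norm (v x - v d) + norm (v d - u d) + norm (u x - u d)"
        using norm_triangle_ineq[of "v x - v d" "v d - u d"]
          norm_triangle_ineq4[of "v x - v d + (v d - u d)" "u x - u d"] by simp
      ultimately show ?thesis
        by linarith
    qed
    \<comment> \<open>The quotient stays within \<open>1/2\<close> of \<open>1\<close>, away from
      the branch cut of \<open>Arg\<close>.\<close>
    have Re_pos: "0 < Re (v x / u x)" if "x \<in> X" for x
    proof -
      have "u x \<noteq> 0"
        using u(2)[OF that] by auto
      then have "norm (v x / u x - 1) = norm (v x - u x)"
        using u(2)[OF that] norm_divide[of "v x - u x" "u x"] by (simp add: diff_divide_distrib)
      then have "\<bar>Re (v x / u x - 1)\<bar> < 1 / 2"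
        using close[OF that] abs_Re_le_cmod[of "v x / u x - 1"] by linarith
      then have "\<bar>Re (v x / u x) - 1\<bar> < 1 / 2"
        by (simp only: minus_complex.sel one_complex.sel)
      then show ?thesis
        by linarith
    qed
    show "\<exists>h. continuous_on X h \<and> (\<forall>x\<in>X. \<bar>h x\<bar> \<le> pi \<and> v x = u x * cis (h x))"
    proof (intro exI conjI ballI)
      show "continuous_on X (\<lambda>x. Arg (v x / u x))"
      proof (intro continuous_on_Arg' continuous_on_divide u v ballI)
        fix x assume x: "x \<in> X"
        show "u x \<noteq> 0"
          using u(2)[OF x] by auto
        show "v x / u x \<notin> \<real>\<^sub>\<le>\<^sub>0"
          using Re_pos[OF x] by (simp add: complex_nonpos_Reals_iff)
      qed
      fix x assume x: "x \<in> X"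
      show "\<bar>Arg (v x / u x)\<bar> \<le> pi"
        using Arg_bounded[of "v x / u x"] by linarith
      have "norm (v x / u x) = 1" "u x \<noteq> 0"
        using u(2)[OF x] v(2)[OF x] by (auto simp: norm_divide)
      then show "v x = u x * cis (Arg (v x / u x))"
        by (subst cis_Arg) (auto simp: sgn_div_norm)
    qed
  qed
qed

section \<open>Heights of continua through a point\<close>

text \<open>The tolerance \<open>pi\<close> is the bound on the angle between maps with the same code.\<close>

definition matched_continuum :: "'a::metric_space set \<Rightarrow> ('a \<Rightarrow> complex) \<Rightarrow> real \<Rightarrow> real \<Rightarrow> 'a \<times> real \<Rightarrow> ('a \<times> real) set \<Rightarrow> bool"
  where "matched_continuum X f lo hi z K \<longleftrightarrow>
    compact K \<and> connected K \<and> K \<subseteq> lift_space X f \<and> z \<in> K \<and> snd ` K \<subseteq> {lo - pi..hi + pi} \<and>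
    (\<exists>s\<in>snd ` K. s \<le> lo + pi) \<and> (\<exists>s\<in>snd ` K. hi - pi \<le> s)"

text \<open>A matched continuum through \<open>z\<close> exists exactly when the component of
  \<open>z\<close> in the slab reaches both end zones \<open>A\<close> and \<open>B\<close>, which
  is a closed condition by \<open>closed_component_meets\<close>.\<close>

lemma closed_matched_continuum:
  fixes X :: "'a::metric_space set"
  assumes "compact X" "continuous_on X f"
  shows "closed {z. \<exists>K. matched_continuum X f lo hi z K}"
proof -
  define Z where "Z = lift_space X f \<inter> UNIV \<times> {lo - pi..hi + pi}"
  define A :: "('a \<times> real) set" where "A = UNIV \<times> {..lo + pi}"
  define B :: "('a \<times> real) set" where "B = UNIV \<times> {hi - pi..}"
  have Z: "compact Z"
    unfolding Z_def using compact_lift_space_slab[OF assms] .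
  have AB: "closed A" "closed B"
    unfolding A_def B_def by (auto intro: closed_Times)
  have "(\<exists>K. matched_continuum X f lo hi z K) \<longleftrightarrow>
      z \<in> Z \<and> connected_component_set Z z \<inter> A \<noteq> {} \<and> connected_component_set Z z \<inter> B \<noteq> {}" (is "?L \<longleftrightarrow> ?R") for z
  proof
    assume ?L
    then obtain K where mc: "matched_continuum X f lo hi z K"
      by blast
    then obtain p q where "p \<in> K" "snd p \<le> lo + pi" "q \<in> K" "hi - pi \<le> snd q"
      unfolding matched_continuum_def by blast
    then have "p \<in> K \<inter> A" "q \<in> K \<inter> B"
      by (simp_all add: A_def B_def mem_Times_iff)
    moreover have "K \<subseteq> Z"
      using mc by (auto simp: matched_continuum_def Z_def)
    ultimately have K: "connected K" "K \<subseteq> Z" "z \<in> K" "K \<inter> A \<noteq> {}" "K \<inter> B \<noteq> {}"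
      using mc unfolding matched_continuum_def by blast+
    then have "K \<subseteq> connected_component_set Z z"
      by (intro connected_component_maximal)
    then show ?R
      using K by blast
  next
    assume R: ?R
    let ?C = "connected_component_set Z z"
    have sub: "?C \<subseteq> Z"
      by (rule connected_component_subset)
    have "closed ?C"
      using closed_connected_component Z compact_imp_closed by blast
    then have "compact ?C"
      using Z sub by (metis compact_Int_closed inf.absorb2)
    moreover have "z \<in> ?C"
      using R by simp
    moreover have "?C \<subseteq> lift_space X f" "snd ` ?C \<subseteq> {lo - pi..hi + pi}"
      using sub by (auto simp: Z_def mem_Times_iff)
    moreover have "\<exists>s\<in>snd ` ?C. s \<le> lo + pi" "\<exists>s\<in>snd ` ?C. hi - pi \<le> s"
      using R by (auto simp: A_def B_def mem_Times_iff)
    ultimately show ?L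
      unfolding matched_continuum_def by (intro exI[of _ ?C]) simp
  qed
  then have "{z. \<exists>K. matched_continuum X f lo hi z K} =
      {z \<in> Z. connected_component_set Z z \<inter> A \<noteq> {}} \<inter> {z \<in> Z. connected_component_set Z z \<inter> B \<noteq> {}}"
    by auto
  then show ?thesis
    using closed_component_meets[OF Z AB(1)] closed_component_meets[OF Z AB(2)] by (simp add: closed_Int)
qed

text \<open>On \<open>E\<close> the height minus the lift \<open>\<psi>\<close> takes values in the
  multiples of \<open>2 * pi\<close>, so it is constant by connectedness.\<close>

lemma lift_increment_over_inessential:
  fixes Z :: "'a::metric_space set"
  assumes "continuous_on Z \<psi>" "\<And>x. x \<in> Z \<Longrightarrow> f x = cis (\<psi> x)"
    and "connected E" "E \<subseteq> lift_space Z f" "p \<in> E" "q \<in> E"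
  shows "snd p - snd q = \<psi> (fst p) - \<psi> (fst q)"
proof -
  have "continuous_on E (\<lambda>p. snd p - \<psi> (fst p))"
    using assms(4) by (intro continuous_intros continuous_on_compose2[OF assms(1)]) (auto simp: lift_space_def)
  moreover have "\<exists>e>0. \<forall>y. y \<in> E \<and> snd y - \<psi> (fst y) \<noteq> snd x - \<psi> (fst x) \<longrightarrow>
      e \<le> norm ((snd y - \<psi> (fst y)) - (snd x - \<psi> (fst x)))" if "x \<in> E" for x
  proof -
    have one: "cis (snd y - \<psi> (fst y)) = 1" if "y \<in> E" for y
    proof -
      have "cis (snd y) = cis (\<psi> (fst y))"
        using assms(2,4) that by (metis mem_lift_space subsetD)
      then show ?thesis
        by (simp add: cis_divide[symmetric])
    qed
    have "2 * pi \<le> norm ((snd y - \<psi> (fst y)) - (snd x - \<psi> (fst x)))"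
      if "y \<in> E" "snd y - \<psi> (fst y) \<noteq> snd x - \<psi> (fst x)" for y
      using cis_eq_cis_close[of "snd y - \<psi> (fst y)" "snd x - \<psi> (fst x)"] one[OF that(1)] one[OF \<open>x \<in> E\<close>] that(2)
      by (metis not_le real_norm_def)
    then show ?thesis
      by (intro exI[of _ "2 * pi"]) auto
  qed
  ultimately have "(\<lambda>p. snd p - \<psi> (fst p)) constant_on E"
    using continuous_discrete_range_constant[OF assms(3)] by blast
  then have "snd p - \<psi> (fst p) = snd q - \<psi> (fst q)"
    using assms(5,6) unfolding constant_on_def by metis
  then show ?thesis
    by simp
qed

text \<open>A continuum over \<open>M\<close> leads from \<open>z\<close> to a point
  \<open>w\<close> over \<open>U\<close>, far from the height \<open>t'\<close> at which matched
  continua over the same base point are available. Translated to \<open>w\<close>, these are not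
  nested with the ones through \<open>z\<close>.\<close>

lemma no_open_matched_set:
  fixes X :: "'a::metric_space set"
  assumes HI: "hereditarily_indecomposable X" and X: "compact X" "continuous_on X f" "\<And>x. x \<in> X \<Longrightarrow> norm (f x) = 1"
    and M: "compact M" "connected M" "M \<subseteq> X" "\<not> inessential M f"
    and U: "U \<subseteq> M" "U \<noteq> {}" "compact (M - U)" "inessential (M - U) f"
    and len: "\<And>n::nat. real n \<le> hi n - lo n"
    and match: "\<And>y. y \<in> U \<Longrightarrow> \<exists>t. \<bar>t - t0\<bar> \<le> pi \<and> f y = cis t \<and> (\<forall>n. \<exists>K. matched_continuum X f (lo n) (hi n) (y, t) K)"
  shows False
proof -
  have contM: "continuous_on M f"
    using X(2) M(3) continuous_on_subset by blast
  have normM: "norm (f x) = 1" if "x \<in> M" for x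
    using X(3) M(3) that by blast
  have HM: "lift_space M f \<subseteq> lift_space X f"
    using M(3) by (rule lift_space_mono)
  obtain \<psi> where \<psi>: "continuous_on (M - U) \<psi>" "\<And>x. x \<in> M - U \<Longrightarrow> f x = cis (\<psi> x)"
    using U(4) unfolding inessential_def by blast
  have "bounded (\<psi> ` (M - U))"
    using U(3) \<psi>(1) by (intro compact_imp_bounded compact_continuous_image)
  then obtain c where c: "c > 0" "\<And>x. x \<in> M - U \<Longrightarrow> \<bar>\<psi> x\<bar> \<le> c"
    by (auto simp: bounded_pos)
  \<comment> \<open>This exceeds the oscillation of \<open>\<psi>\<close> on \<open>M - U\<close>,
    so a continuum over \<open>M\<close> with two heights at distance \<open>D\<close> must meet the
    part over \<open>U\<close>.\<close>
  define D where "D = 2 * c + 1"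
  \<comment> \<open>Both \<open>t\<close> and \<open>t'\<close> lie within \<open>pi\<close> of
    \<open>t0\<close>, and \<open>w\<close> will lie within \<open>D\<close> of a point
    \<open>e\<close> at height distance \<open>R\<close> from \<open>t\<close>. Hence
    \<open>w\<close> is at least \<open>R - D - 2 * pi = 3 * pi\<close> away from
    \<open>t'\<close>.\<close>
  define R where "R = D + 5 * pi"
  have D: "D > 2 * c" "D > 0"
    using c(1) by (auto simp: D_def)
  have R: "R > 0"
    using D(2) pi_gt_zero unfolding R_def by linarith
  obtain y t where y: "y \<in> U" "\<bar>t - t0\<bar> \<le> pi" "f y = cis t"
    and match_y: "\<And>n. \<exists>K. matched_continuum X f (lo n) (hi n) (y, t) K"
    using U(2) match by (metis ex_in_conv)
  define z where "z = (y, t)"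
  have zH: "z \<in> lift_space M f"
    using y U(1) by (auto simp: z_def lift_space_def)
  obtain K0 where K0: "compact K0" "connected K0" "K0 \<subseteq> lift_space M f" "z \<in> K0"
    "t - R \<in> snd ` K0 \<or> t + R \<in> snd ` K0"
    by (rule lift_space_continuum_to_boundary[OF M(1,2) contM normM M(4) zH, of "t - R" "t + R"])
      (use R in \<open>auto simp: z_def\<close>)
  then obtain e where e: "e \<in> K0" "\<bar>snd e - t\<bar> = R"
    using R by force
  have eH: "e \<in> lift_space M f"
    using e K0 by blast
  obtain E where E: "compact E" "connected E" "E \<subseteq> lift_space M f" "e \<in> E" "snd ` E \<subseteq> {snd e - D..snd e + D}"
    "snd e - D \<in> snd ` E \<or> snd e + D \<in> snd ` E"
    by (rule lift_space_continuum_to_boundary[OF M(1,2) contM normM M(4) eH, of "snd e - D" "snd e + D"])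
      (use D in auto)
  obtain e' where e': "e' \<in> E" "\<bar>snd e' - snd e\<bar> = D"
    using E(6) D(2) by force
  have "\<exists>w\<in>E. fst w \<in> U"
  proof (rule ccontr)
    assume "\<not> (\<exists>w\<in>E. fst w \<in> U)"
    then have sub: "E \<subseteq> lift_space (M - U) f"
      using E(3) by (auto simp: lift_space_def)
    have "snd e' - snd e = \<psi> (fst e') - \<psi> (fst e)"
      using lift_increment_over_inessential[OF \<psi> E(2) sub e'(1) E(4)] .
    moreover have "fst e' \<in> M - U" "fst e \<in> M - U"
      using sub e'(1) E(4) mem_lift_space by (metis subsetD)+
    ultimately show False
      using c(2)[of "fst e'"] c(2)[of "fst e"] e'(2) D(1) by linarith
  qed
  then obtain w where w: "w \<in> E" "fst w \<in> U"
    by blast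
  obtain t' where t': "\<bar>t' - t0\<bar> \<le> pi" "f (fst w) = cis t'"
    and match_w: "\<And>n. \<exists>K. matched_continuum X f (lo n) (hi n) (fst w, t') K"
    using match[OF w(2)] by blast
  define \<Delta> where "\<Delta> = snd w - t'"
  have "\<bar>snd w - snd e\<bar> \<le> D"
    using E(5) w(1) by force
  then have \<Delta>: "\<bar>\<Delta>\<bar> > 2 * pi"
    using e(2) y(2) t'(1) pi_gt_zero unfolding \<Delta>_def R_def by linarith
  have "f (fst w) = cis (snd w)"
    using w(1) E(3) by (metis mem_lift_space subsetD)
  then have "cis \<Delta> = 1"
    using t'(2) by (simp add: \<Delta>_def cis_divide[symmetric])
  then have shift: "cis (s + \<Delta>) = cis s" for s
    by (simp add: cis_mult[symmetric])
  define L where "L = K0 \<union> E"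
  have L: "compact L" "connected L" "L \<subseteq> lift_space X f" "z \<in> L" "w \<in> L"
    using K0 E e w HM unfolding L_def by (auto intro: compact_Un connected_Un)
  have "bounded (snd ` L)"
    using L(1) by (intro compact_imp_bounded compact_continuous_image continuous_intros)
  then obtain b where b: "\<And>p. p \<in> L \<Longrightarrow> \<bar>snd p\<bar> \<le> b"
    by (auto simp: bounded_iff)
  \<comment> \<open>A matched continuum for this \<open>n\<close> has two heights at least
    \<open>real n - 2 * pi > 2 * b\<close> apart, too far for it to lie in \<open>L\<close>; so it
    contains \<open>L\<close> and with it \<open>w\<close>.\<close>
  obtain n :: nat where n: "2 * b + 2 * pi < real n"
    using reals_Archimedean2 by blast
  obtain K where K: "matched_continuum X f (lo n) (hi n) z K"
    using match_y z_def by blast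
  obtain K' where K': "matched_continuum X f (lo n) (hi n) (fst w, t') K'"
    using match_w by blast
  have "K \<subseteq> L \<or> L \<subseteq> K"
    using lift_continua_nested[OF HI, of K f L] K L by (auto simp: matched_continuum_def)
  moreover have "\<not> K \<subseteq> L"
  proof
    assume "K \<subseteq> L"
    moreover obtain p q where "p \<in> K" "snd p \<le> lo n + pi" "q \<in> K" "hi n - pi \<le> snd q"
      using K by (auto simp: matched_continuum_def)
    ultimately have "\<bar>snd p\<bar> \<le> b" "\<bar>snd q\<bar> \<le> b"
      using b by blast+
    with \<open>snd p \<le> lo n + pi\<close> \<open>hi n - pi \<le> snd q\<close> show False
      using n len[of n] by linarith
  qed
  ultimately have wK: "w \<in> K"
    using L(5) by blast
  \<comment> \<open>The deck transformation by \<open>\<Delta>\<close> moves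
    \<open>(fst w, t')\<close> to \<open>w\<close>, so \<open>K''\<close> and \<open>K\<close>
    meet.\<close>
  define K'' where "K'' = (\<lambda>p. (fst p, snd p + \<Delta>)) ` K'"
  have "compact K''" "connected K''" "K'' \<subseteq> lift_space X f"
    using K' shift unfolding K''_def matched_continuum_def
    by (auto intro!: compact_continuous_image connected_continuous_image continuous_intros simp: lift_space_def)
  moreover have "w \<in> K''"
    unfolding K''_def using K' by (intro image_eqI[of _ _ "(fst w, t')"]) (auto simp: matched_continuum_def \<Delta>_def prod_eq_iff)
  ultimately have "K \<subseteq> K'' \<or> K'' \<subseteq> K"
    using lift_continua_nested[OF HI, of K f K''] K wK by (auto simp: matched_continuum_def)
  then have nested: "snd ` K \<subseteq> snd ` K'' \<or> snd ` K'' \<subseteq> snd ` K"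
    by blast
  have sndK'': "snd ` K'' = (\<lambda>s. s + \<Delta>) ` (snd ` K')"
    unfolding K''_def by (auto simp: image_image)
  obtain p q where p: "p \<in> snd ` K" "p \<le> lo n + pi" and q: "q \<in> snd ` K" "hi n - pi \<le> q"
    using K unfolding matched_continuum_def by blast
  obtain p' q' where p': "p' \<in> snd ` K'" "p' \<le> lo n + pi" and q': "q' \<in> snd ` K'" "hi n - pi \<le> q'"
    using K' unfolding matched_continuum_def by blast
  have bK: "lo n - pi \<le> s \<and> s \<le> hi n + pi" if "s \<in> snd ` K" for s
    using K that unfolding matched_continuum_def by (metis atLeastAtMost_iff subsetD)
  have bK'': "lo n - pi + \<Delta> \<le> s \<and> s \<le> hi n + pi + \<Delta>" if "s \<in> snd ` K''" for s
    using K' that unfolding matched_continuum_def sndK'' by fastforce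
  have mem'': "p' + \<Delta> \<in> snd ` K''" "q' + \<Delta> \<in> snd ` K''"
    using p' q' sndK'' by auto
  \<comment> \<open>Each end of a matched continuum is known up to \<open>pi\<close>, so the ends of
    two of them agree up to \<open>2 * pi\<close>; a shift by more than that moves both ends clearly
    the same way.\<close>
  from nested show False
  proof
    assume "snd ` K \<subseteq> snd ` K''"
    then show False
      using bK''[of p] bK''[of q] subsetD[of _ _ p] subsetD[of _ _ q] p q \<Delta> by (smt (verit) subsetD)
  next
    assume "snd ` K'' \<subseteq> snd ` K"
    then have "p' + \<Delta> \<in> snd ` K" "q' + \<Delta> \<in> snd ` K"
      using mem'' by blast+
    then show False
      using bK[of "p' + \<Delta>"] bK[of "q' + \<Delta>"] p'(2) q'(2) \<Delta> by linarith
  qed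
qed

text \<open>Some continuum runs from \<open>(x, t)\<close> to a height at distance \<open>n\<close>;
  its extreme heights, attained by compactness, serve as \<open>lo n\<close> and
  \<open>hi n\<close>.\<close>

lemma long_continua_at_point:
  fixes f :: "'a::metric_space \<Rightarrow> complex"
  assumes "compact X" "connected X" "continuous_on X f" "\<And>x. x \<in> X \<Longrightarrow> norm (f x) = 1"
    and "\<not> inessential X f" "x \<in> X"
  obtains t lo hi L where "f x = cis t"
    "\<And>n::nat. compact (L n) \<and> connected (L n) \<and> L n \<subseteq> lift_space X f \<and> (x, t) \<in> L n \<and>
      snd ` L n \<subseteq> {lo n..hi n} \<and> lo n \<in> snd ` L n \<and> hi n \<in> snd ` L n \<and> real n \<le> hi n - lo n"
proof -
  have fx: "f x = cis (Arg (f x))"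
    using assms(4)[OF assms(6)] by (subst cis_Arg) (auto simp: sgn_div_norm)
  define t where "t = Arg (f x)"
  have z: "(x, t) \<in> lift_space X f"
    using fx assms(6) by (simp add: lift_space_def t_def)
  have "\<exists>K lo hi. compact K \<and> connected K \<and> K \<subseteq> lift_space X f \<and> (x, t) \<in> K \<and>
      snd ` K \<subseteq> {lo..hi} \<and> lo \<in> snd ` K \<and> hi \<in> snd ` K \<and> real n \<le> hi - lo" for n
  proof -
    obtain K where K: "compact K" "connected K" "K \<subseteq> lift_space X f" "(x, t) \<in> K"
      "t - real n \<in> snd ` K \<or> t + real n \<in> snd ` K"
      by (rule lift_space_continuum_to_boundary[OF assms(1-5) z, of "t - real n" "t + real n"]) auto
    have t: "t \<in> snd ` K"
      using K(4) by force
    have "compact (snd ` K)"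
      using K(1) by (intro compact_continuous_image continuous_intros)
    then obtain lo hi where lo: "lo \<in> snd ` K" "\<forall>s\<in>snd ` K. lo \<le> s" and hi: "hi \<in> snd ` K" "\<forall>s\<in>snd ` K. s \<le> hi"
      using compact_attains_inf[of "snd ` K"] compact_attains_sup[of "snd ` K"] t by blast
    have "lo \<le> t" "t \<le> hi"
      using lo(2) hi(2) t by blast+
    moreover have "lo \<le> t - real n \<or> t + real n \<le> hi"
      using lo(2) hi(2) K(5) by blast
    ultimately have "real n \<le> hi - lo"
      by linarith
    moreover have "snd ` K \<subseteq> {lo..hi}"
      using lo(2) hi(2) by (meson atLeastAtMost_iff subsetI)
    ultimately show ?thesis
      using K lo(1) hi(1) by blast
  qed
  then obtain L lo hi where "\<And>n. compact (L n) \<and> connected (L n) \<and> L n \<subseteq> lift_space X f \<and> (x, t) \<in> L n \<and>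
      snd ` L n \<subseteq> {lo n..hi n} \<and> lo n \<in> snd ` L n \<and> hi n \<in> snd ` L n \<and> real n \<le> hi n - lo n"
    by metis
  then show thesis
    using that fx t_def by blast
qed

text \<open>Since \<open>f (g y)\<close> differs from \<open>u y\<close> by the angle
  \<open>h y\<close>, sending \<open>(y, s)\<close> to \<open>(g y, s + h y)\<close> maps the
  covering space of \<open>u\<close> into that of \<open>f\<close> and changes heights by at most
  \<open>pi\<close>.\<close>

lemma matched_continuum_image:
  fixes X :: "'a::metric_space set"
  assumes L: "compact L" "connected L" "L \<subseteq> lift_space X u" "(x, t) \<in> L" "snd ` L \<subseteq> {lo..hi}"
      "lo \<in> snd ` L" "hi \<in> snd ` L"
    and g: "continuous_on X g" "g ` X \<subseteq> X"
    and h: "continuous_on X h" "\<And>y. y \<in> X \<Longrightarrow> \<bar>h y\<bar> \<le> pi"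
    and f: "\<And>y. y \<in> X \<Longrightarrow> f (g y) = u y * cis (h y)"
  shows "matched_continuum X f lo hi (g x, t + h x) ((\<lambda>p. (g (fst p), snd p + h (fst p))) ` L)"
proof -
  let ?k = "\<lambda>p. (g (fst p), snd p + h (fst p))"
  have LX: "fst p \<in> X" "u (fst p) = cis (snd p)" if "p \<in> L" for p
    using L(3) that by (metis mem_lift_space subsetD)+
  have "continuous_on L ?k"
    using LX(1) by (intro continuous_intros continuous_on_compose2[OF g(1)] continuous_on_compose2[OF h(1)]) auto
  then have "compact (?k ` L)" "connected (?k ` L)"
    using L(1,2) by (auto intro: compact_continuous_image connected_continuous_image)
  moreover have "?k ` L \<subseteq> lift_space X f"
  proof
    fix q assume "q \<in> ?k ` L"
    then obtain p where p: "p \<in> L" "q = ?k p"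
      by blast
    then have "f (g (fst p)) = cis (snd p + h (fst p))"
      using f[OF LX(1)[OF p(1)]] LX(2)[OF p(1)] by (simp add: cis_mult)
    moreover have "g (fst p) \<in> X"
      using g(2) LX(1)[OF p(1)] by blast
    ultimately show "q \<in> lift_space X f"
      using p(2) by (simp add: lift_space_def)
  qed
  moreover have "(g x, t + h x) \<in> ?k ` L"
    using L(4) by (intro image_eqI[of _ _ "(x, t)"]) auto
  moreover have bnd: "\<bar>h (fst p)\<bar> \<le> pi" if "p \<in> L" for p
    using h(2) LX(1) that by blast
  have "snd ` ?k ` L \<subseteq> {lo - pi..hi + pi}"
  proof -
    have "lo - pi \<le> snd p + h (fst p)" "snd p + h (fst p) \<le> hi + pi" if "p \<in> L" for p
    proof -
      have "snd p \<in> {lo..hi}"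
        using L(5) that by blast
      then show "lo - pi \<le> snd p + h (fst p)" "snd p + h (fst p) \<le> hi + pi"
        using bnd[OF that] by auto
    qed
    then show ?thesis
      by (auto simp: image_image)
  qed
  moreover have "\<exists>s\<in>snd ` ?k ` L. s \<le> lo + pi"
  proof -
    obtain p where p: "p \<in> L" "lo = snd p"
      using L(6) by blast
    then have "snd p + h (fst p) \<le> lo + pi"
      using bnd[OF p(1)] by linarith
    then show ?thesis
      using p(1) by (force simp: image_image)
  qed
  moreover have "\<exists>s\<in>snd ` ?k ` L. hi - pi \<le> s"
  proof -
    obtain p where p: "p \<in> L" "hi = snd p"
      using L(7) by blast
    then have "hi - pi \<le> snd p + h (fst p)"
      using bnd[OF p(1)] by linarith
    then show ?thesis
      using p(1) by (force simp: image_image)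
  qed
  ultimately show ?thesis
    unfolding matched_continuum_def by blast
qed

section \<open>Baire category over the countably many codes\<close>

lemma Baire_compact_cover:
  fixes M :: "'a::metric_space set" and S :: "'i::countable \<Rightarrow> 'a set"
  assumes "compact M" "M \<noteq> {}" "\<And>i. closedin (top_of_set M) (S i)" "M \<subseteq> (\<Union>i. S i)"
  obtains i U where "openin (top_of_set M) U" "U \<noteq> {}" "U \<subseteq> S i"
proof -
  have "\<exists>i. top_of_set M interior_of S i \<noteq> {}"
  proof (rule ccontr)
    assume neg: "\<not> ?thesis"
    have "top_of_set M interior_of \<Union>(range S) = {}"
    proof (rule Baire_category_alt)
      show "completely_metrizable_space (top_of_set M) \<or>
          locally_compact_space (top_of_set M) \<and> regular_space (top_of_set M)"
        using assms(1) by (simp add: compact_imp_locally_compact_space compact_space_subtopology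
            metrizable_imp_regular_space metrizable_space_subtopology metrizable_space_euclidean)
      show "countable (range S)"
        by simp
    qed (use assms(3) neg in auto)
    moreover have "\<Union>(range S) = M"
      using assms(4) closedin_imp_subset[OF assms(3)] by blast
    ultimately have "top_of_set M interior_of topspace (top_of_set M) = {}"
      by simp
    then show False
      using assms(2) unfolding interior_of_topspace by simp
  qed
  then obtain i where "top_of_set M interior_of S i \<noteq> {}" ..
  then show thesis
    using that openin_interior_of interior_of_subset by metis
qed

text \<open>Surjections \<open>g y\<close> reach every point \<open>y\<close> from a single point
  \<open>x0\<close>. Sorting the maps \<open>f \<circ> g y\<close> by code covers \<open>M\<close>
  by countably many closed sets; one of them has interior in \<open>M\<close>, against
  \<open>no_open_matched_set\<close>.\<close>

lemma essential_imp_not_continuously_homogeneous: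
  fixes X :: "'a::metric_space set"
  assumes X: "continuum X" and HI: "hereditarily_indecomposable X"
    and f: "continuous_on X f" "\<And>x. x \<in> X \<Longrightarrow> norm (f x) = 1" "\<not> inessential X f"
  shows "\<not> continuously_homogeneous X"
proof
  assume hom: "continuously_homogeneous X"
  have comp: "compact X" and conn: "connected X"
    using X by (auto simp: continuum_def)
  have nonempty: "A \<noteq> {}" if "\<not> inessential A f" for A
    using that by (auto simp: inessential_def)
  obtain x0 where x0: "x0 \<in> X"
    using nonempty[OF f(3)] by blast
  have "\<forall>y\<in>X. \<exists>g. continuous_on X g \<and> g ` X = X \<and> g x0 = y"
    using hom x0 unfolding continuously_homogeneous_def by blast
  then obtain g where g: "\<And>y. y \<in> X \<Longrightarrow> continuous_on X (g y)" "\<And>y. y \<in> X \<Longrightarrow> g y ` X = X"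
      "\<And>y. y \<in> X \<Longrightarrow> g y x0 = y"
    by metis
  define u where "u y = f \<circ> g y" for y
  have u: "continuous_on X (u y)" "\<not> inessential X (u y)" if "y \<in> X" for y
  proof -
    show "continuous_on X (u y)"
      unfolding u_def using g(1,2)[OF that] f(1) by (intro continuous_on_compose) auto
    show "\<not> inessential X (u y)"
      unfolding u_def using essential_comp_surjection[OF HI X g(1,2)[OF that] f(3)] .
  qed
  have norm_u: "norm (u y x) = 1" if "y \<in> X" "x \<in> X" for x y
    using that f(2) g(2) by (auto simp: u_def)
  obtain M where M: "compact M" "connected M" "M \<subseteq> X" "\<not> inessential M f"
    and minM: "\<And>N. \<lbrakk>compact N; N \<subset> M\<rbrakk> \<Longrightarrow> inessential N f"
    using minimal_essential_subset[OF comp f] by blast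
  obtain code :: "('a \<Rightarrow> complex) \<Rightarrow> nat \<times> (int \<times> int) list"
    where code: "\<And>u v. \<lbrakk>continuous_on X u; continuous_on X v; \<And>x. x \<in> X \<Longrightarrow> norm (u x) = 1;
        \<And>x. x \<in> X \<Longrightarrow> norm (v x) = 1; code u = code v\<rbrakk>
      \<Longrightarrow> \<exists>h. continuous_on X h \<and> (\<forall>x\<in>X. \<bar>h x\<bar> \<le> pi \<and> v x = u x * cis (h x))"
    using circle_map_code[OF comp] by blast
  \<comment> \<open>One representative point per code; the default \<open>x0\<close> keeps
    \<open>r c\<close> in \<open>X\<close>, so \<open>u (r c)\<close> is essential even for codes
    that do not occur.\<close>
  define r where "r c = (if \<exists>y\<in>X. code (u y) = c then SOME y. y \<in> X \<and> code (u y) = c else x0)" for c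
  have rX: "r c \<in> X" for c
  proof (cases "\<exists>y\<in>X. code (u y) = c")
    case True
    then have "\<exists>y. y \<in> X \<and> code (u y) = c"
      by blast
    from someI_ex[OF this] show ?thesis
      using True by (simp add: r_def)
  qed (use x0 in \<open>simp add: r_def\<close>)
  have r_code: "code (u (r (code (u y)))) = code (u y)" if "y \<in> X" for y
  proof -
    have "\<exists>y'. y' \<in> X \<and> code (u y') = code (u y)"
      using that by blast
    from someI_ex[OF this] show ?thesis
      using that by (auto simp: r_def)
  qed
  \<comment> \<open>For each code, one height and one sequence of ever longer continua at
    \<open>x0\<close> are fixed, to serve all points with that code.\<close>
  define good where "good c t lo hi L \<longleftrightarrow> u (r c) x0 = cis t \<and>
    (\<forall>n::nat. compact (L n) \<and> connected (L n) \<and> L n \<subseteq> lift_space X (u (r c)) \<and> (x0, t) \<in> L n \<and>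
      snd ` L n \<subseteq> {lo n..hi n} \<and> lo n \<in> snd ` L n \<and> hi n \<in> snd ` L n \<and> real n \<le> hi n - lo n)"
    for c t lo hi L
  have "\<exists>t lo hi L. good c t lo hi L" for c
    using long_continua_at_point[OF comp conn u(1)[OF rX] norm_u[OF rX] u(2)[OF rX] x0, of c]
    unfolding good_def by metis
  then obtain t0 lo hi L where good: "\<And>c. good c (t0 c) (lo c) (hi c) (L c)"
    by metis
  \<comment> \<open>Confining the height to an interval makes \<open>Y c\<close> compact, so that
    its projection is closed.\<close>
  define Y where "Y c = lift_space X f \<inter> UNIV \<times> {t0 c - pi..t0 c + pi} \<inter>
      (\<Inter>n. {z. \<exists>K. matched_continuum X f (lo c n) (hi c n) z K})" for c
  have "compact (Y c)" for c
    unfolding Y_def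
    by (intro compact_Int_closed compact_lift_space_slab comp f closed_INT ballI closed_matched_continuum)
  then have "compact (fst ` Y c)" for c
    by (intro compact_continuous_image continuous_intros)
  then have closedin_Y: "closedin (top_of_set M) (M \<inter> fst ` Y c)" for c
    by (simp add: closedin_closed_Int compact_imp_closed)
  \<comment> \<open>A point \<open>y\<close> lies in the set of its own code: \<open>g y\<close>,
    corrected by the angle \<open>h\<close> to the representative map, carries the chosen continua
    at \<open>x0\<close> to matched ones at \<open>y\<close>.\<close>
  have cover: "M \<subseteq> (\<Union>c. M \<inter> fst ` Y c)"
  proof
    fix y assume yM: "y \<in> M"
    then have y: "y \<in> X"
      using M(3) by blast
    define c where "c = code (u y)"
    obtain h where h: "continuous_on X h" "\<And>x. x \<in> X \<Longrightarrow> \<bar>h x\<bar> \<le> pi"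
        "\<And>x. x \<in> X \<Longrightarrow> u y x = u (r c) x * cis (h x)"
      using code[OF u(1)[OF rX] u(1)[OF y] norm_u[OF rX] norm_u[OF y]] r_code[OF y] unfolding c_def by metis
    define t where "t = t0 c + h x0"
    have "\<exists>K. matched_continuum X f (lo c n) (hi c n) (y, t) K" for n
    proof -
      have Ln: "compact (L c n)" "connected (L c n)" "L c n \<subseteq> lift_space X (u (r c))" "(x0, t0 c) \<in> L c n"
        "snd ` L c n \<subseteq> {lo c n..hi c n}" "lo c n \<in> snd ` L c n" "hi c n \<in> snd ` L c n"
        using good[of c] unfolding good_def by blast+
      have "f (g y x) = u (r c) x * cis (h x)" if "x \<in> X" for x
        using h(3)[OF that] by (simp add: u_def)
      from matched_continuum_image[OF Ln g(1)[OF y] _ h(1,2) this] g(2,3)[OF y] show ?thesis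
        unfolding t_def by auto
    qed
    moreover have "f y = cis t"
    proof -
      have "f y = u (r c) x0 * cis (h x0)"
        using h(3)[OF x0] g(3)[OF y] by (simp add: u_def)
      moreover have "u (r c) x0 = cis (t0 c)"
        using good[of c] unfolding good_def by blast
      ultimately show ?thesis
        by (simp add: t_def cis_mult)
    qed
    moreover have "\<bar>t - t0 c\<bar> \<le> pi"
      using h(2)[OF x0] by (simp add: t_def)
    then have "t \<in> {t0 c - pi..t0 c + pi}"
      by auto
    ultimately have "(y, t) \<in> Y c"
      using y unfolding Y_def by (simp add: lift_space_def)
    then show "y \<in> (\<Union>c. M \<inter> fst ` Y c)"
      using yM by (intro UN_I[of c] IntI image_eqI[of _ _ "(y, t)"]) auto
  qed
  obtain c U where U: "openin (top_of_set M) U" "U \<noteq> {}" "U \<subseteq> M \<inter> fst ` Y c"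
    using Baire_compact_cover[OF M(1) nonempty[OF M(4)] closedin_Y cover] by metis
  have "closedin (top_of_set M) (M - U)"
    using U(1) by (intro closedin_diff closedin_subtopology_refl[THEN iffD2]) auto
  then have compU: "compact (M - U)"
    using M(1) closedin_compact by blast
  have "inessential (M - U) f"
    using minM[OF compU] U(2,3) by blast
  moreover have "\<exists>t. \<bar>t - t0 c\<bar> \<le> pi \<and> f y = cis t \<and>
      (\<forall>n. \<exists>K. matched_continuum X f (lo c n) (hi c n) (y, t) K)" if y: "y \<in> U" for y
  proof -
    obtain t where t: "(y, t) \<in> Y c"
      using U(3) y by force
    then have "\<bar>t - t0 c\<bar> \<le> pi" "f y = cis t"
      by (auto simp: Y_def lift_space_def abs_le_iff)
    moreover have "\<forall>n. \<exists>K. matched_continuum X f (lo c n) (hi c n) (y, t) K"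
      using t unfolding Y_def by blast
    ultimately show ?thesis
      by blast
  qed
  moreover have "U \<subseteq> M"
    using U(3) by blast
  moreover have "real n \<le> hi c n - lo c n" for n
    using good[of c] unfolding good_def by blast
  ultimately show False
    using no_open_matched_set[OF HI comp f(1,2) M _ U(2) compU] by blast
qed

section \<open>From essential embeddings to essential circle-valued maps\<close>

theorem lemma3p3:
  fixes X :: "'a::metric_space set"
  assumes "continuum X"
    and "hereditarily_indecomposable X"
    and "embeds_essentially X (sphere (0::complex) 1 \<times> hilbert_cube)"
  shows "\<not> continuously_homogeneous X"
proof -
  obtain e where "essential_map X (sphere (0::complex) 1 \<times> hilbert_cube) e"
    using assms(3) unfolding embeds_essentially_def by blast
  then have e: "continuous_on X e" "e ` X \<subseteq> sphere 0 1 \<times> hilbert_cube"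
    and ess: "\<And>c. c \<in> sphere 0 1 \<times> hilbert_cube \<Longrightarrow>
      \<not> homotopic_with_canon (\<lambda>_. True) X (sphere 0 1 \<times> hilbert_cube) e (\<lambda>_. c)"
    unfolding essential_map_def by blast+
  have ex: "fst (e x) \<in> sphere 0 1" "snd (e x) \<in> hilbert_cube" if "x \<in> X" for x
    using e(2) that by (auto simp: mem_Times_iff)
  have "\<not> inessential X (fst \<circ> e)"
  proof
    assume "inessential X (fst \<circ> e)"
    then obtain \<phi> where \<phi>: "continuous_on X \<phi>" "\<And>x. x \<in> X \<Longrightarrow> fst (e x) = cis (\<phi> x)"
      unfolding inessential_def by auto
    \<comment> \<open>If the circle coordinate had a lift, scaling the lift and the cube coordinates
      down to zero would contract \<open>e\<close> to the point
      \<open>(1, \<lambda>_. 0)\<close>.\<close>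
    define H where "H = (\<lambda>p. (cis ((1 - fst p) * \<phi> (snd p)), \<lambda>n. (1 - fst p) * snd (e (snd p)) n))"
    have "homotopic_with_canon (\<lambda>_. True) X (sphere 0 1 \<times> hilbert_cube) e (\<lambda>_. (1, \<lambda>_. 0))"
    proof (subst homotopic_with, simp, intro exI conjI ballI)
      have "continuous_on ({0..1} \<times> X) (\<lambda>p. snd (e (snd p)))"
        by (intro continuous_intros continuous_on_compose2[OF e(1)]) auto
      then have "continuous_on ({0..1} \<times> X) (\<lambda>p. snd (e (snd p)) n)" for n
        by (rule continuous_on_product_then_coordinatewise)
      then have "continuous_on ({0..1} \<times> X) (\<lambda>p. \<lambda>n. (1 - fst p) * snd (e (snd p)) n)"
        by (intro continuous_on_coordinatewise_then_product continuous_intros)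
      moreover have "continuous_on ({0..1} \<times> X) (\<lambda>p. cis ((1 - fst p) * \<phi> (snd p)))"
        unfolding cis_conv_exp by (intro continuous_intros continuous_on_compose2[OF \<phi>(1)]) auto
      ultimately have "continuous_on ({0..1} \<times> X) H"
        unfolding H_def by (intro continuous_on_Pair)
      moreover have "H ` ({0..1} \<times> X) \<subseteq> sphere 0 1 \<times> hilbert_cube"
      proof -
        have "(1 - s) * snd (e x) n \<in> {0..1}" if "s \<in> {0..1}" "x \<in> X" for s x n
        proof -
          have "snd (e x) n \<in> {0..1}"
            using ex(2)[OF that(2)] by (auto simp: hilbert_cube_def)
          then show ?thesis
            using that(1) by (auto intro: mult_le_one)
        qed
        then show ?thesis
          by (auto simp: H_def hilbert_cube_def)
      qed
      ultimately show "continuous_map (prod_topology (top_of_set {0..1}) (top_of_set X))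
          (top_of_set (sphere 0 1 \<times> hilbert_cube)) H"
        by (simp add: continuous_map_subtopology_eu prod_topology_subtopology_eu image_subset_iff_funcset)
    qed (use \<phi> in \<open>auto simp: H_def prod_eq_iff\<close>)
    moreover have "(1, \<lambda>_. 0) \<in> sphere (0::complex) 1 \<times> hilbert_cube"
      by (simp add: hilbert_cube_def)
    ultimately show False
      using ess by blast
  qed
  moreover have "continuous_on X (fst \<circ> e)"
    using e(1) unfolding comp_def by (intro continuous_intros)
  moreover have "norm ((fst \<circ> e) x) = 1" if "x \<in> X" for x
    using ex(1)[OF that] by simp
  ultimately show ?thesis
    using essential_imp_not_continuously_homogeneous[OF assms(1,2)] by blast
qed

end
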